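(* Let $\alpha>0$ and let $S$ and $S'$ be two finite trees of sizes $k_1,k_2\ge 3$. Then the limit $$d(S,S')=\lim_{n\to\infty} d_{TV}\big(T_n^{S},T_n^{S'}\big)$$ exists, and it is non-zero whenever $S$ is not graph-isomorphic to $S'$.
   Context: The size $|T|$ of a tree $T$ is its number of vertices. Fix a real parameter $\alpha>0$. For a finite seed tree $S$ of size $k\ge 2$, the $\alpha$-PA (affine preferential attachment) trees $(T_n^S)_{n\ge k}$ grown from $S$ are the random trees defined recursively as follows: $T_k^S=S$, and given $T_k^S,\dots,T_N^S$ with $T_N^S=T$ (a tree of size $N$), a random vertex $u_N$ of $T$ is selected with $$\mathbb P(u_N=u\mid T_k^S,\dots,T_N^S)=\frac{\deg_T(u)-1+\alpha}{(1+\alpha)N-2}\qquad (u\in T),$$ and $T_{N+1}^S$ is obtained by adding a new vertex and joining it to $u_N$ by an edge. $d_{TV}(T_n^S,T_n^{S'})$ (defined for $n\ge\max(k_1,k_2)$) is the total variation distance between the laws of $T_n^S$ and $T_n^{S'}$, regarded as random unlabelled trees (i.e. random isomorphism classes of finite trees), where $d_{TV}(X,Y)=\sup_A|\mathbb P(X\in A)-\mathbb P(Y\in A)|$, equivalently the infimum of $\mathbb P(X'\ne Y')$ over all couplings $(X',Y')$ of $X$ and $Y$. *)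

theory Defs
  imports
    "HOL-Probability.Probability"
    "Graph_Theory.Pair_Digraph"
    "Graph_Theory.Digraph_Isomorphism"
begin

text \<open>
  A simple graph is a symmetric loop-free digraph (\<^locale>\<open>pair_graph\<close>), every edge being a pair of
  opposite arcs. The library's \<^const>\<open>tree\<close> does not fit this encoding: it forbids every directed
  cycle, and the two arcs of an edge form a directed cycle of length 2. The cycles of the
  undirected graph are the directed cycles of length at least 3.
\<close>

locale pair_tree = pair_graph +
  assumes tree_connected: "Digraph_Component.connected (with_proj G)"
    and tree_acyclic: "\<not> (\<exists>p. pre_digraph.cycle (with_proj G) p \<and> 3 \<le> length p)"

definition graph_size :: "'v pair_pre_digraph \<Rightarrow> nat" where
  "graph_size G = card (pverts G)"

text \<open>By symmetry of the arc set, the degree of a vertex is its out-degree.\<close>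

definition attach_pmf :: "real \<Rightarrow> 'v pair_pre_digraph \<Rightarrow> 'v pmf" where
  "attach_pmf \<alpha> T = embed_pmf (\<lambda>u.
     if u \<in> pverts T
     then (real (out_degree (with_proj T) u) - 1 + \<alpha>) / ((1 + \<alpha>) * real (graph_size T) - 2)
     else 0)"

definition add_leaf :: "'v \<Rightarrow> 'v \<Rightarrow> 'v pair_pre_digraph \<Rightarrow> 'v pair_pre_digraph" where
  "add_leaf u v T = \<lparr> pverts = insert v (pverts T), parcs = {(u, v), (v, u)} \<union> parcs T \<rparr>"

text \<open>
  The vertices of the growing tree are those of the seed (tagged \<^const>\<open>Inl\<close>) and the added ones
  (tagged \<^const>\<open>Inr\<close>); the vertex added to a tree of size \<open>N\<close> is \<open>Inr N\<close>, which is fresh.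
\<close>

definition seed_embed :: "'a pair_pre_digraph \<Rightarrow> ('a + nat) pair_pre_digraph" where
  "seed_embed S = \<lparr> pverts = Inl ` pverts S, parcs = map_prod Inl Inl ` parcs S \<rparr>"

definition pa_step :: "real \<Rightarrow> ('a + nat) pair_pre_digraph \<Rightarrow> ('a + nat) pair_pre_digraph pmf" where
  "pa_step \<alpha> T = map_pmf (\<lambda>u. add_leaf u (Inr (graph_size T)) T) (attach_pmf \<alpha> T)"

primrec pa_grow :: "real \<Rightarrow> 'a pair_pre_digraph \<Rightarrow> nat \<Rightarrow> ('a + nat) pair_pre_digraph pmf" where
  "pa_grow \<alpha> S 0 = return_pmf (seed_embed S)"
| "pa_grow \<alpha> S (Suc m) = bind_pmf (pa_grow \<alpha> S m) (pa_step \<alpha>)"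

text \<open>The law of the labelled tree of size \<open>n\<close> grown from \<open>S\<close>; only meaningful for \<open>n \<ge> graph_size S\<close>.\<close>

definition pa_tree :: "real \<Rightarrow> 'a pair_pre_digraph \<Rightarrow> nat \<Rightarrow> ('a + nat) pair_pre_digraph pmf" where
  "pa_tree \<alpha> S n = pa_grow \<alpha> S (n - graph_size S)"

text \<open>
  The isomorphism class of a finite graph, represented by all its isomorphic copies with vertices in
  \<^typ>\<open>nat\<close>, so that graphs with different vertex types can be compared.
\<close>

definition iso_class :: "'v pair_pre_digraph \<Rightarrow> nat pair_pre_digraph set" where
  "iso_class G = {H. digraph_iso (with_proj G) (with_proj H)}"

definition unlabelled_pa_tree :: "real \<Rightarrow> 'a pair_pre_digraph \<Rightarrow> nat \<Rightarrow> nat pair_pre_digraph set pmf" where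
  "unlabelled_pa_tree \<alpha> S n = map_pmf iso_class (pa_tree \<alpha> S n)"

definition tv_dist :: "'x pmf \<Rightarrow> 'x pmf \<Rightarrow> real" where
  "tv_dist p q = (SUP A. \<bar>measure_pmf.prob p A - measure_pmf.prob q A\<bar>)"

section \<open>Sanity checks\<close>

text \<open>
  The numbers in \<^const>\<open>attach_pmf\<close> form a probability mass function on every tree of size at least 2
  (\<open>pmf_attach_pmf\<close>), growing a leaf preserves trees (\<open>pair_tree_add_leaf\<close>), and \<^const>\<open>iso_class\<close>
  separates trees exactly up to isomorphism (\<open>iso_class_eq_iff\<close>).
\<close>

context pair_tree begin

lemma arc_sym: "(u, v) \<in> parcs G \<Longrightarrow> (v, u) \<in> parcs G"
  using pair_sym_arcs by (auto simp: symmetric_def dest: symD)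

lemma mk_symmetric_self: "mk_symmetric (with_proj G) = G"
proof -
  have "(\<Union>e\<in>parcs G. {(fst e, snd e), (snd e, fst e)}) = parcs G"
    using arc_sym by auto
  thus ?thesis by (simp add: mk_symmetric_def)
qed

lemma verts_nonempty: "pverts G \<noteq> {}"
  and reach: "u \<in> pverts G \<Longrightarrow> v \<in> pverts G \<Longrightarrow> u \<rightarrow>\<^sup>*\<^bsub>with_proj G\<^esub> v"
  using tree_connected
  by (auto simp: Digraph_Component.connected_def strongly_connected_def mk_symmetric_self)

lemma leave_set:
  assumes "W \<subseteq> pverts G" "W \<noteq> {}" "W \<noteq> pverts G"
  shows "\<exists>w v. (w, v) \<in> parcs G \<and> w \<in> W \<and> v \<notin> W"
proof (rule ccontr)
  assume neg: "\<not> ?thesis"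
  obtain r v where rv: "r \<in> W" "v \<in> pverts G" "v \<notin> W" using assms by blast
  have "r \<rightarrow>\<^sup>*\<^bsub>with_proj G\<^esub> v" using reach rv assms by blast
  hence "v \<in> W"
  proof (induction rule: reachable_induct)
    case base thus ?case using rv by simp
  next
    case (step x y) thus ?case using neg by auto
  qed
  thus False using rv by simp
qed

text \<open>Vertex sets inducing a connected subgraph with the edge count of a tree; used only to count edges.\<close>

definition grown :: "'a set \<Rightarrow> bool" where
  "grown W \<longleftrightarrow> W \<subseteq> pverts G \<and> W \<noteq> {} \<and>
     (\<forall>a\<in>W. \<forall>b\<in>W. \<exists>p. apath a p b \<and> set (pawalk_verts a p) \<subseteq> W) \<and>
     card (parcs G \<inter> W \<times> W) + 2 = 2 * card W"

lemma grown_step: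
  assumes W: "grown W" and e: "(w, v) \<in> parcs G" "w \<in> W" "v \<notin> W"
  shows "grown (insert v W)"
proof -
  have sub: "W \<subseteq> pverts G" and ne: "W \<noteq> {}"
    and con: "\<And>a b. a \<in> W \<Longrightarrow> b \<in> W \<Longrightarrow> \<exists>p. apath a p b \<and> set (pawalk_verts a p) \<subseteq> W"
    and crd: "card (parcs G \<inter> W \<times> W) + 2 = 2 * card W"
    using W unfolding grown_def by blast+
  have finW: "finite W" using sub pair_finite_verts finite_subset by blast
  have vV: "v \<in> pverts G" using e in_arcsD2 by blast
  have uniq: "w' = w" if w': "(w', v) \<in> parcs G" "w' \<in> W" for w'
  proof (rule ccontr)
    assume ne: "w' \<noteq> w"
    obtain p where p: "apath w' p w" "set (pawalk_verts w' p) \<subseteq> W" using con[OF w'(2) e(2)] by blast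
    have aw: "awalk w' p w" using p(1) awalkI_apath by blast
    have pne: "p \<noteq> []" using p(1) ne by (auto simp: apath_Nil_iff)
    have "awalk v ((v, w') # p @ [(w, v)]) v"
      using aw arc_sym[OF w'(1)] e vV by (auto simp: awalk_simps)
    moreover have "pawalk_verts w' (p @ [(w, v)]) = pawalk_verts w' p @ [v]"
      using awalk_verts_append[of w' p "[(w,v)]" v] aw e vV by (auto simp: awalk_simps)
    moreover have "distinct (pawalk_verts w' p)" using p(1) by (auto simp: apath_def)
    moreover have "v \<notin> set (pawalk_verts w' p)" using p(2) e by blast
    ultimately have "cycle ((v, w') # p @ [(w, v)])"
      unfolding cycle_def by (intro exI[of _ v]) auto
    moreover have "3 \<le> length ((v, w') # p @ [(w, v)])" using pne by (cases p) auto
    ultimately show False using tree_acyclic by blast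
  qed
  have arcs: "parcs G \<inter> insert v W \<times> insert v W = {(w, v), (v, w)} \<union> (parcs G \<inter> W \<times> W)"
  proof (intro set_eqI iffI)
    fix x assume x: "x \<in> parcs G \<inter> insert v W \<times> insert v W"
    obtain a b where ab: "x = (a, b)" by (cases x)
    have "(a, b) \<in> parcs G" "a \<noteq> b" using x ab pair_no_loops[of x] by auto
    thus "x \<in> {(w, v), (v, w)} \<union> (parcs G \<inter> W \<times> W)"
      using x uniq[of a] uniq[of b] arc_sym[of a b] by (auto simp: ab)
  next
    fix x assume "x \<in> {(w, v), (v, w)} \<union> (parcs G \<inter> W \<times> W)"
    thus "x \<in> parcs G \<inter> insert v W \<times> insert v W" using e arc_sym[OF e(1)] by auto
  qed
  have "w \<noteq> v" using e by blast
  hence "card {(w, v), (v, w)} = 2" by simp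
  hence "card (parcs G \<inter> insert v W \<times> insert v W) = 2 + card (parcs G \<inter> W \<times> W)"
    unfolding arcs using e pair_finite_arcs by (subst card_Un_disjoint) auto
  hence 1: "card (parcs G \<inter> insert v W \<times> insert v W) + 2 = 2 * card (insert v W)"
    using crd e finW by simp
  have "\<exists>p. apath a p b \<and> set (pawalk_verts a p) \<subseteq> insert v W"
    if ab: "a \<in> insert v W" "b \<in> insert v W" for a b
  proof -
    consider "a \<in> W" "b \<in> W" | "a = v" "b \<in> W" | "a \<in> W" "b = v" | "a = v" "b = v" using ab by blast
    thus ?thesis
    proof cases
      case 1 thus ?thesis using con[of a b] by blast
    next
      case 2
      then obtain p where p: "apath w p b" "set (pawalk_verts w p) \<subseteq> W" using con e by blast
      hence "apath v ((v, w) # p) b" using e arc_sym by (auto simp: apath_Cons_iff)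
      thus ?thesis using p 2 by (intro exI[of _ "(v, w) # p"]) auto
    next
      case 3
      then obtain p where p: "apath a p w" "set (pawalk_verts a p) \<subseteq> W" using con e by blast
      have aw: "awalk a p w" using p(1) awalkI_apath by blast
      have v: "pawalk_verts a (p @ [(w, v)]) = pawalk_verts a p @ [v]"
        using awalk_verts_append[of a p "[(w,v)]" v] aw e vV by (auto simp: awalk_simps)
      have "awalk a (p @ [(w, v)]) v" using aw e vV by (auto simp: awalk_simps)
      moreover have "distinct (pawalk_verts a (p @ [(w, v)]))"
        using p e unfolding v by (auto simp: apath_def)
      ultimately have "apath a (p @ [(w, v)]) v" by (auto simp: apath_def)
      thus ?thesis using p 3 v by (intro exI[of _ "p @ [(w, v)]"]) auto
    next
      case 4 thus ?thesis using vV by (intro exI[of _ "[]"]) (auto simp: apath_Nil_iff)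
    qed
  qed
  thus ?thesis using 1 sub vV unfolding grown_def by blast
qed

lemma card_parcs: "card (parcs G) + 2 = 2 * card (pverts G)"
proof -
  obtain r where r: "r \<in> pverts G" using verts_nonempty by blast
  have r': "grown {r}" unfolding grown_def
    using r pair_no_loops[of "(r, r)"] by (auto simp: apath_Nil_iff intro!: exI[of _ "[]"])
  have "finite {W. grown W}"
    by (rule finite_subset[of _ "Pow (pverts G)"]) (auto simp: grown_def pair_finite_verts)
  then obtain W where W: "grown W" and mx: "\<And>W'. grown W' \<Longrightarrow> W \<subseteq> W' \<Longrightarrow> W' = W"
    using finite_has_maximal2[of "{W. grown W}" "{r}"] r' by auto
  have "W = pverts G"
  proof (rule ccontr)
    assume "W \<noteq> pverts G"
    then obtain w v where "(w, v) \<in> parcs G" "w \<in> W" "v \<notin> W"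
      using leave_set[of W] W unfolding grown_def by blast
    thus False using mx[of "insert v W"] grown_step[OF W] by blast
  qed
  moreover have "parcs G \<inter> pverts G \<times> pverts G = parcs G" using wellformed' by auto
  ultimately show ?thesis using W unfolding grown_def by simp
qed

lemma degree_pos:
  assumes "2 \<le> graph_size G" "u \<in> pverts G"
  shows "1 \<le> out_degree (with_proj G) u"
proof -
  have "card {u} \<noteq> card (pverts G)" using assms by (simp add: graph_size_def)
  hence "{u} \<noteq> pverts G" by metis
  then obtain v where "(u, v) \<in> parcs G" using leave_set[of "{u}"] assms by auto
  hence "out_arcs (with_proj G) u \<noteq> {}" by (auto simp: out_arcs_def)
  moreover have "finite (out_arcs (with_proj G) u)" using pair_finite_arcs by (simp add: out_arcs_def)
  ultimately show ?thesis by (simp add: out_degree_def Suc_le_eq card_gt_0_iff)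
qed

lemma sum_degree: "(\<Sum>u\<in>pverts G. out_degree (with_proj G) u) = card (parcs G)"
proof -
  have "card (\<Union>u\<in>pverts G. out_arcs (with_proj G) u) = (\<Sum>u\<in>pverts G. card (out_arcs (with_proj G) u))"
    by (rule card_UN_disjoint) (auto simp: pair_finite_verts out_arcs_def pair_finite_arcs)
  moreover have "(\<Union>u\<in>pverts G. out_arcs (with_proj G) u) = parcs G"
    using in_arcsD1 by (auto simp: out_arcs_def)
  ultimately show ?thesis by (simp add: out_degree_def)
qed

lemma pmf_attach_pmf:
  assumes "0 < \<alpha>" "2 \<le> graph_size G"
  shows "pmf (attach_pmf \<alpha> G) u =
    (if u \<in> pverts G
     then (real (out_degree (with_proj G) u) - 1 + \<alpha>) / ((1 + \<alpha>) * real (graph_size G) - 2) else 0)"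
    (is "_ = ?f u")
proof -
  let ?D = "(1 + \<alpha>) * real (graph_size G) - 2"
  have "(1 + \<alpha>) * 2 \<le> (1 + \<alpha>) * real (graph_size G)" using assms by (intro mult_left_mono) auto
  hence D: "?D > 0" using assms by simp
  have nn: "0 \<le> ?f x" for x
    using degree_pos[OF assms(2), of x] D assms by (auto intro!: divide_nonneg_pos)
  have "(\<Sum>x\<in>pverts G. ?f x) = (\<Sum>x\<in>pverts G. real (out_degree (with_proj G) x) - 1 + \<alpha>) / ?D"
    by (simp add: sum_divide_distrib)
  also have "(\<Sum>x\<in>pverts G. real (out_degree (with_proj G) x) - 1 + \<alpha>)
      = real (card (parcs G)) + (\<alpha> - 1) * real (graph_size G)"
    by (simp add: sum.distrib sum_subtractf graph_size_def flip: sum_degree) (simp add: algebra_simps)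
  also have "\<dots> = ?D" using card_parcs assms by (simp add: graph_size_def algebra_simps)
  finally have s: "(\<Sum>x\<in>pverts G. ?f x) = 1" using D by simp
  have "(\<integral>\<^sup>+x. ennreal (?f x) \<partial>count_space UNIV) = (\<Sum>x\<in>pverts G. ennreal (?f x))"
    by (rule nn_integral_count_space') (use pair_finite_verts in auto)
  also have "\<dots> = ennreal (\<Sum>x\<in>pverts G. ?f x)" by (rule sum_ennreal) (rule nn)
  also have "\<dots> = 1" using s by simp
  finally show ?thesis unfolding attach_pmf_def by (subst pmf_embed_pmf[OF nn]) auto
qed

end


lemma iso_class_eq_iff:
  assumes G: "pair_tree G" and H: "pair_tree H"
  shows "iso_class G = iso_class H \<longleftrightarrow> digraph_iso (with_proj G) (with_proj H)"
proof -
  interpret G: pair_tree G by fact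
  interpret H: pair_tree H by fact
  have wf: "wf_digraph (with_proj G)" "wf_digraph (with_proj H)"
    using G.wf_digraph H.wf_digraph by blast+
  obtain f :: "_ \<Rightarrow> nat" where f: "inj_on f (pverts G)"
    using finite_imp_inj_to_nat_seg[OF G.pair_finite_verts] by metis
  define K where "K = \<lparr> pverts = f ` pverts G, parcs = map_prod f f ` parcs G \<rparr>"
  have inj: "inj_on (map_prod f f) (parcs G)"
    by (rule inj_on_subset[OF map_prod_inj_on[OF f f]]) (use G.in_arcsD1 G.in_arcsD2 in auto)
  have GK: "digraph_iso (with_proj G) (with_proj K)"
    unfolding digraph_iso_def
    by (rule exI[of _ "\<lparr> iso_verts = f, iso_arcs = map_prod f f, iso_head = snd, iso_tail = fst \<rparr>"])
       (use f inj wf in \<open>auto simp: pre_digraph.digraph_isomorphism_def app_iso_def with_proj_def K_def\<close>)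
  show ?thesis
  proof
    assume "iso_class G = iso_class H"
    hence "digraph_iso (with_proj H) (with_proj K)" using GK by (auto simp: iso_class_def)
    thus "digraph_iso (with_proj G) (with_proj H)"
      using digraph_iso_trans[OF GK] digraph_iso_swap[OF wf(2)] by blast
  next
    assume GH: "digraph_iso (with_proj G) (with_proj H)"
    show "iso_class G = iso_class H" unfolding iso_class_def
      using digraph_iso_trans[OF GH] digraph_iso_trans[OF digraph_iso_swap[OF wf(1) GH]] by blast
  qed
qed


lemma pcas_append: "pcas x (p @ q) y \<longleftrightarrow> (\<exists>z. pcas x p z \<and> pcas z q y)"
  by (induction p arbitrary: x) auto

lemma pcas_snd_last: "pcas x p y \<Longrightarrow> p \<noteq> [] \<Longrightarrow> y \<in> snd ` set p"
proof (induction p arbitrary: x)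
  case (Cons e p)
  thus ?case by (cases p) auto
qed simp

lemma pawalk_verts_eq: "pcas x p y \<Longrightarrow> pawalk_verts x p = x # map snd p"
  by (induction p arbitrary: x) auto

lemma pair_tree_add_leaf:
  assumes G: "pair_tree G" and u: "u \<in> pverts G" and v: "v \<notin> pverts G"
  shows "pair_tree (add_leaf u v G)"
proof -
  interpret G: pair_tree G by fact
  let ?H = "add_leaf u v G"
  have V: "pverts ?H = insert v (pverts G)" and A: "parcs ?H = {(u, v), (v, u)} \<union> parcs G"
    by (auto simp: add_leaf_def)
  interpret H: pair_graph ?H
  proof
    show "symmetric (with_proj ?H)"
      using G.arc_sym by (auto simp: symmetric_def A intro!: symI)
  qed (use u v G.pair_finite_verts G.pair_finite_arcs G.in_arcsD1 G.in_arcsD2 G.pair_no_loops in \<open>auto simp: V A\<close>)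
  have sym: "(a, b) \<in> parcs ?H \<Longrightarrow> (b, a) \<in> parcs ?H" for a b
    using G.arc_sym by (auto simp: A)
  have mk: "mk_symmetric (with_proj ?H) = ?H"
  proof -
    have "(\<Union>e\<in>parcs ?H. {(fst e, snd e), (snd e, fst e)}) = parcs ?H" using sym by auto
    thus ?thesis by (simp add: mk_symmetric_def)
  qed
  have mono: "a \<rightarrow>\<^sup>*\<^bsub>with_proj ?H\<^esub> b" if "a \<rightarrow>\<^sup>*\<^bsub>with_proj G\<^esub> b" for a b
    using that
  proof (induction rule: G.reachable_induct)
    case base
    thus ?case by (intro H.reachable_refl) (simp add: V)
  next
    case (step x y)
    hence "(x, y) \<in> parcs ?H" by (simp add: A)
    with step.IH show ?case by (rule H.reachable_adj_trans)
  qed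
  have ru: "a \<rightarrow>\<^sup>*\<^bsub>with_proj ?H\<^esub> u" if "a \<in> pverts ?H" for a
  proof (cases "a = v")
    case True
    have "(v, u) \<in> parcs ?H" by (simp add: A)
    thus ?thesis unfolding True by (rule H.reachable_adjI)
  next
    case False
    hence "a \<rightarrow>\<^sup>*\<^bsub>with_proj G\<^esub> u" using G.reach u that by (auto simp: V)
    thus ?thesis by (rule mono)
  qed
  have con: "Digraph_Component.connected (with_proj ?H)"
  proof -
    have "a \<rightarrow>\<^sup>*\<^bsub>with_proj ?H\<^esub> b" if "a \<in> pverts ?H" "b \<in> pverts ?H" for a b
      by (rule H.reachable_trans[OF ru[OF that(1)] H.symmetric_reachable'[OF ru[OF that(2)]]])
    thus ?thesis
      unfolding Digraph_Component.connected_def strongly_connected_def mk by (simp add: V)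
  qed
  have acy: "\<not> (H.cycle p \<and> 3 \<le> length p)" for p
  proof
    assume "H.cycle p \<and> 3 \<le> length p"
    then obtain x where x: "H.awalk x p x" and ds: "distinct (tl (pawalk_verts x p))" and l: "3 \<le> length p"
      unfolding H.cycle_def by auto
    have cas: "pcas x p x" and ar: "set p \<subseteq> parcs ?H" and xV: "x \<in> pverts ?H"
      using x by (auto simp: H.awalk_def)
    have d: "distinct (map snd p)" using ds pawalk_verts_eq[OF cas] by simp
    show False
    proof (cases "v \<in> snd ` set p")
      case True
      then obtain a where "(a, v) \<in> set p" by force
      moreover from this have "a = u" using ar v G.in_arcsD2 by (auto simp: A)
      ultimately obtain q r where p: "p = q @ (u, v) # r" by (metis split_list)
      have c: "pcas x q u" "pcas v r x" using cas by (auto simp: p pcas_append)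
      have nuv: "u \<noteq> v" using u v by blast
      have out: "hd s = (v, u)" if "pcas v s y" "s \<noteq> []" "set s \<subseteq> parcs ?H" for s y
        using that v G.in_arcsD1 by (cases s) (auto simp: A)
      show False
      proof (cases r)
        case Nil
        hence xv: "x = v" using c by simp
        have q: "q \<noteq> []" using l p Nil by auto
        then obtain q' where q': "q = (v, u) # q'" using out[of q u] c ar xv by (cases q) (auto simp: p)
        hence "pcas u q' u" "q' \<noteq> []" using c l p Nil by auto
        hence "u \<in> snd ` set q'" using pcas_snd_last by metis
        thus False using d by (auto simp: p q')
      next
        case (Cons e r')
        hence r: "r = (v, u) # r'" using out[of r x] c ar by (auto simp: p)
        have q: "q = []"
        proof (rule ccontr)
          assume "q \<noteq> []"
          hence "u \<in> snd ` set q" using pcas_snd_last c by metis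
          thus False using d by (auto simp: p r)
        qed
        hence "pcas u r' u" "r' \<noteq> []" using c l p r by auto
        hence "u \<in> snd ` set r'" using pcas_snd_last by metis
        thus False using d by (auto simp: p r)
      qed
    next
      case False
      moreover have "p \<noteq> []" using l by auto
      ultimately have xv: "x \<noteq> v" using pcas_snd_last[OF cas] by auto
      have "v \<notin> fst ` set p"
      proof
        assume "v \<in> fst ` set p"
        then obtain b where "(v, b) \<in> set p" by force
        then obtain q r where p: "p = q @ (v, b) # r" by (metis split_list)
        have c: "pcas x q v" using cas by (auto simp: p pcas_append)
        hence "q \<noteq> []" using xv by auto
        hence "v \<in> snd ` set p" using pcas_snd_last[OF c] by (auto simp: p)
        thus False using False by simp
      qed
      hence "set p \<subseteq> parcs G" using ar False by (force simp: A)
      hence "G.awalk x p x" using cas xV xv by (auto simp: G.awalk_def V)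
      thus False using ds l \<open>p \<noteq> []\<close> G.tree_acyclic unfolding G.cycle_def by blast
    qed
  qed
  show ?thesis
    by unfold_locales (use con acy in \<open>auto\<close>)
qed

end

theory Submission
  imports Defs
begin

text \<open>
  On isomorphism classes the process is a Markov chain, so the distance decreases and converges.

  Put \<open>x(v) = deg v - 1 + \<alpha>\<close>, so that \<open>v\<close> is selected with probability \<open>x(v) / Z(n)\<close>, where \<open>Z(n)\<close> is the
  sum of all \<open>x(v)\<close>. Rising factorials turn this into an exact linear system: for a finite graph \<open>\<tau>\<close>
  with exponents \<open>l\<close>, let \<open>F(\<tau>, l)\<close> be the sum over all embeddings \<open>f\<close> of \<open>\<tau>\<close> of the products of the
  rising factorials of order \<open>l(a)\<close> at \<open>x(f a)\<close>. Its conditional expectation after one step is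
  \<open>1 + |l| / Z(n)\<close> times its current value plus a combination of \<open>F(\<tau>', l')\<close> with smaller \<open>\<tau>'\<close>, coming
  from the embeddings that use the new leaf.

  If the two seeds (grown to a common size) are distinguished by some \<open>F(\<tau>, l)\<close> with all exponents
  above \<open>1 + \<alpha>\<close>, choose such a \<open>\<tau>\<close> with the fewest vertices. The lower order terms then cancel, and the
  difference of the expectations is exactly a constant times the product of the factors
  \<open>1 + |l| / Z(i)\<close>. The square of \<open>F(\<tau>, l)\<close> is dominated by a sum over all pairs of maps, which obeys a
  similar linear system; as the exponents exceed \<open>1 + \<alpha>\<close>, its expectation is at most a constant times
  the square of that product. A difference of expectations comparable to the second moments
  bounds the total variation distance from below. A distinguishing \<open>F(\<tau>, l)\<close> exists because a
  tree \<open>\<tau>\<close> of the common size embeds only in the trees of that size that are isomorphic to it.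
\<close>

section \<open>Weighted sums over maps and embeddings\<close>

definition wt :: "'v set \<Rightarrow> ('v \<Rightarrow> real) \<Rightarrow> ('v \<Rightarrow> nat) \<Rightarrow> real" where
  "wt V x m = (\<Prod>v\<in>V. pochhammer (x v) (m v))"

text \<open>Points with a common image add their exponents before the rising factorial is taken.
  This keeps \<open>all_sum\<close> closed under the attachment step even for maps that are not
  injective.\<close>

definition load :: "'p set \<Rightarrow> ('p \<Rightarrow> nat) \<Rightarrow> ('p \<Rightarrow> 'v) \<Rightarrow> 'v \<Rightarrow> nat" where
  "load A l f v = (\<Sum>a | a \<in> A \<and> f a = v. l a)"

definition all_sum :: "'v set \<Rightarrow> ('v \<Rightarrow> real) \<Rightarrow> 'p set \<Rightarrow> ('p \<Rightarrow> nat) \<Rightarrow> real" where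
  "all_sum V x A l = (\<Sum>f \<in> A \<rightarrow>\<^sub>E V. wt V x (load A l f))"

text \<open>Injective homomorphisms, not necessarily induced. Only the arcs of \<open>E\<close>
  inside \<open>A\<close> are tested, so deleting a pattern vertex shrinks \<open>A\<close> and
  leaves \<open>E\<close> alone.\<close>

definition embeddings :: "'p set \<Rightarrow> 'p rel \<Rightarrow> 'v set \<Rightarrow> 'v rel \<Rightarrow> ('p \<Rightarrow> 'v) set" where
  "embeddings A E V R =
     {f \<in> A \<rightarrow>\<^sub>E V. inj_on f A \<and> (\<forall>a\<in>A. \<forall>b\<in>A. (a, b) \<in> E \<longrightarrow> (f a, f b) \<in> R)}"

definition emb_sum ::
  "'v set \<Rightarrow> ('v \<Rightarrow> real) \<Rightarrow> 'v rel \<Rightarrow> 'p set \<Rightarrow> 'p rel \<Rightarrow> ('p \<Rightarrow> nat) \<Rightarrow> real" where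
  "emb_sum V x R A E l = (\<Sum>f \<in> embeddings A E V R. wt V x (load A l f))"

definition nbrs :: "'p rel \<Rightarrow> 'p set \<Rightarrow> 'p \<Rightarrow> 'p set" where
  "nbrs E A a = {b \<in> A. (a, b) \<in> E \<or> (b, a) \<in> E}"

section \<open>Weights under a unit increase of one value\<close>

lemma wt_cong:
  assumes "\<And>v. v \<in> V \<Longrightarrow> x v = y v" "\<And>v. v \<in> V \<Longrightarrow> m v = m' v"
  shows "wt V x m = wt V y m'"
  using assms by (simp add: wt_def)

lemma wt_insert:
  "finite V \<Longrightarrow> w \<notin> V \<Longrightarrow> wt (insert w V) x m = pochhammer (x w) (m w) * wt V x m"
  by (simp add: wt_def)

lemma wt_pos: "(\<And>v. v \<in> V \<Longrightarrow> 0 < x v) \<Longrightarrow> 0 < wt V x m"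
  unfolding wt_def by (intro prod_pos) (auto simp: pochhammer_pos)

text \<open>The rising factorial of order \<open>m + 1\<close> at \<open>x\<close> is
  \<open>x\<close> times that of order \<open>m\<close> at \<open>x + 1\<close>, and also
  \<open>x + m\<close> times that of order \<open>m\<close> at \<open>x\<close>.\<close>

lemma wt_raise:
  assumes "finite V" "u \<in> V"
  shows "x u * wt V (x(u := x u + 1)) m = (x u + real (m u)) * wt V x m"
proof -
  have "wt V y m = pochhammer (y u) (m u) * wt (V - {u}) y m" for y
    unfolding wt_def by (rule prod.remove) (use assms in auto)
  moreover have "wt (V - {u}) (x(u := x u + 1)) m = wt (V - {u}) x m" by (rule wt_cong) auto
  moreover have "x u * pochhammer (x u + 1) (m u) = pochhammer (x u) (m u) * (x u + real (m u))"
    by (metis pochhammer_rec pochhammer_Suc)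
  ultimately show ?thesis by (simp add: mult.assoc[symmetric])
qed

text \<open>The same product read as a rising factorial of one order more. This is the case where
  the attachment vertex is forced to be the image of a pattern vertex.\<close>

lemma wt_raise_load:
  assumes "finite V" "u \<in> V"
  shows "x u * wt V (x(u := x u + 1)) m = wt V x (m(u := Suc (m u)))"
proof -
  have "wt V x m' = pochhammer (x u) (m' u) * wt (V - {u}) x m'" for m'
    unfolding wt_def by (rule prod.remove) (use assms in auto)
  moreover have "wt (V - {u}) x (m(u := Suc (m u))) = wt (V - {u}) x m" by (rule wt_cong) auto
  ultimately show ?thesis using assms by (simp add: wt_raise pochhammer_Suc)
qed

text \<open>The factor depends on the load only through its total, so a fitness-biased attachment
  multiplies all weights of the same total load by one scalar on average.\<close>

lemma sum_wt_raise:
  assumes "finite V"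
  shows "(\<Sum>u\<in>V. x u * wt V (x(u := x u + 1)) m) = (sum x V + real (sum m V)) * wt V x m"
  using assms by (simp add: wt_raise sum_distrib_right sum.distrib distrib_right)

text \<open>Splitting off the first \<open>m\<close> factors on the right leaves a rising factorial
  of order \<open>n\<close> that starts at \<open>x + m\<close> instead of \<open>x\<close>.\<close>

lemma pochhammer_mult_le:
  fixes x :: real
  assumes "0 < x"
  shows "pochhammer x m * pochhammer x n \<le> pochhammer x (m + n)"
proof -
  have "pochhammer x n \<le> pochhammer (x + real m) n"
    unfolding pochhammer_prod by (intro prod_mono) (use assms in auto)
  then show ?thesis
    unfolding pochhammer_product' by (intro mult_left_mono) (auto simp: assms pochhammer_pos less_imp_le)
qed

lemma wt_mult_le:
  assumes "\<And>v. v \<in> V \<Longrightarrow> 0 < x v"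
  shows "wt V x m * wt V x m' \<le> wt V x (\<lambda>v. m v + m' v)"
  unfolding wt_def prod.distrib[symmetric]
  by (intro prod_mono conjI pochhammer_mult_le mult_nonneg_nonneg less_imp_le[OF pochhammer_pos] assms)

lemma sum_load:
  assumes "finite A" "finite V" "f ` A \<subseteq> V"
  shows "sum (load A l f) V = sum l A"
  unfolding load_def using assms by (intro sum.group) auto

lemma load_cong:
  "(\<And>a. a \<in> A \<Longrightarrow> f a = g a) \<Longrightarrow> load A l f = load A l g"
  unfolding load_def by (intro ext sum.cong) auto

lemma finite_embeddings: "finite A \<Longrightarrow> finite V \<Longrightarrow> finite (embeddings A E V R)"
  unfolding embeddings_def by (rule finite_subset[OF _ finite_PiE]) auto

section \<open>Recursion for sums over all maps\<close>

text \<open>A map into \<open>insert w V\<close> splits into the set \<open>J\<close> of points sent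
  to \<open>w\<close> and an extensional map of the other points into \<open>V\<close>; the load at
  \<open>w\<close> is \<open>sum l J\<close>.\<close>

lemma all_sum_insert:
  assumes "finite A" "finite V" "w \<notin> V"
  shows "all_sum (insert w V) x A l
    = (\<Sum>J\<in>Pow A. pochhammer (x w) (sum l J) * all_sum V x (A - J) l)"
proof -
  let ?S = "SIGMA J:Pow A. (A - J) \<rightarrow>\<^sub>E V"
  have fin: "finite (B \<rightarrow>\<^sub>E V)" if "B \<subseteq> A" for B
    using assms that by (auto intro!: finite_PiE intro: finite_subset)
  have "(\<Sum>J\<in>Pow A. pochhammer (x w) (sum l J) * all_sum V x (A - J) l)
    = (\<Sum>(J, g)\<in>?S. pochhammer (x w) (sum l J) * wt V x (load (A - J) l g))"
    unfolding all_sum_def sum_distrib_left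
    by (rule sum.Sigma) (use assms in \<open>auto simp: fin\<close>)
  also have "\<dots> = (\<Sum>f\<in>A \<rightarrow>\<^sub>E insert w V. wt (insert w V) x (load A l f))"
  proof (rule sum.reindex_bij_witness[of _
        "\<lambda>f. ({a \<in> A. f a = w}, restrict f {a \<in> A. f a \<noteq> w})"
        "\<lambda>(J, g) a. if a \<in> J then w else g a"], goal_cases)
    case (1 p)
    obtain J g where p: "p = (J, g)" by (cases p)
    have J: "J \<subseteq> A" and g: "g \<in> (A - J) \<rightarrow>\<^sub>E V" using 1 p by auto
    have "{a \<in> A. (if a \<in> J then w else g a) = w} = J"
      using J g assms(3) by (auto simp: PiE_iff)
    moreover have "restrict (\<lambda>a. if a \<in> J then w else g a)
        {a \<in> A. (if a \<in> J then w else g a) \<noteq> w} = g"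
      using J g assms(3) by (fastforce simp: PiE_iff restrict_def extensional_def)
    ultimately show ?case by (simp add: p)
  next
    case (2 p)
    then show ?case by (auto simp: PiE_iff extensional_def split: if_splits)
  next
    case (3 f)
    then show ?case by (auto simp: PiE_iff extensional_def restrict_def)
  next
    case (4 f)
    then show ?case by (auto simp: PiE_iff extensional_def restrict_def)
  next
    case (5 p)
    obtain J g where p: "p = (J, g)" by (cases p)
    have J: "J \<subseteq> A" and g: "g \<in> (A - J) \<rightarrow>\<^sub>E V" using 5 p by auto
    let ?f = "\<lambda>a. if a \<in> J then w else g a"
    have "{a \<in> A. ?f a = w} = J" using J g assms(3) by (auto simp: PiE_iff)
    then have "load A l ?f w = sum l J" by (simp add: load_def)
    moreover have "load A l ?f v = load (A - J) l g v" if "v \<in> V" for v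
      unfolding load_def by (rule sum.cong) (use that assms(3) in auto)
    ultimately show ?case
      using assms by (simp add: p wt_insert cong: wt_cong)
  qed
  finally show ?thesis by (simp add: all_sum_def)
qed

text \<open>The points \<open>J\<close> over the new vertex contribute a rising factorial at its
  value \<alpha>; for the other points \<open>sum_wt_raise\<close> evaluates the sum over
  \<open>u\<close>. The set \<open>J = {}\<close> gives the leading term, any other \<open>J\<close>
  a smaller point set.\<close>

lemma all_sum_step:
  assumes "finite A" "finite V" "w \<notin> V"
  shows "(\<Sum>u\<in>V. x u * all_sum (insert w V) (x(u := x u + 1, w := \<alpha>)) A l)
    = (\<Sum>J\<in>Pow A. pochhammer \<alpha> (sum l J) * ((sum x V + real (sum l (A - J))) * all_sum V x (A - J) l))"
proof -
  have eq: "all_sum V (x(u := x u + 1, w := \<alpha>)) B l = all_sum V (x(u := x u + 1)) B l" for u B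
    unfolding all_sum_def by (intro sum.cong wt_cong) (use assms in auto)
  have *: "(\<Sum>u\<in>V. x u * all_sum V (x(u := x u + 1)) B l)
      = (sum x V + real (sum l B)) * all_sum V x B l" if "B \<subseteq> A" for B
  proof -
    have B: "finite B" using that assms finite_subset by blast
    have "(\<Sum>u\<in>V. x u * all_sum V (x(u := x u + 1)) B l)
      = (\<Sum>f\<in>B \<rightarrow>\<^sub>E V. \<Sum>u\<in>V. x u * wt V (x(u := x u + 1)) (load B l f))"
      unfolding all_sum_def sum_distrib_left by (rule sum.swap)
    also have "\<dots> = (\<Sum>f\<in>B \<rightarrow>\<^sub>E V. (sum x V + real (sum l B)) * wt V x (load B l f))"
      by (intro sum.cong refl, subst sum_wt_raise, simp add: assms, subst sum_load)
         (use assms B in \<open>auto simp: PiE_iff\<close>)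
    finally show ?thesis by (simp add: all_sum_def sum_distrib_left)
  qed
  have "(\<Sum>u\<in>V. x u * all_sum (insert w V) (x(u := x u + 1, w := \<alpha>)) A l)
    = (\<Sum>u\<in>V. \<Sum>J\<in>Pow A. pochhammer \<alpha> (sum l J) * (x u * all_sum V (x(u := x u + 1)) (A - J) l))"
    using assms by (simp add: all_sum_insert eq sum_distrib_left mult_ac)
  also have "\<dots> = (\<Sum>J\<in>Pow A. pochhammer \<alpha> (sum l J) *
      (\<Sum>u\<in>V. x u * all_sum V (x(u := x u + 1)) (A - J) l))"
    unfolding sum_distrib_left by (rule sum.swap)
  also have "\<dots> = (\<Sum>J\<in>Pow A. pochhammer \<alpha> (sum l J) *
      ((sum x V + real (sum l (A - J))) * all_sum V x (A - J) l))"
    by (intro sum.cong refl) (simp add: *)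
  finally show ?thesis .
qed

section \<open>Recursion for sums over embeddings\<close>

text \<open>Injectivity allows at most one \<open>a\<close> over the new leaf \<open>w\<close>. As
  \<open>u\<close> is the only neighbour of \<open>w\<close>, all pattern neighbours of
  \<open>a\<close> must lie over \<open>u\<close>; irreflexivity keeps \<open>a\<close> itself out
  of \<open>nbrs E A a\<close>.\<close>

lemma embeddings_insert:
  assumes w: "w \<notin> V" and u: "u \<in> V" and R: "R \<subseteq> V \<times> V" and E: "irrefl E"
  shows "embeddings A E (insert w V) ({(u, w), (w, u)} \<union> R) = embeddings A E V R \<union>
    (\<Union>a\<in>A. (\<lambda>g. g(a := w)) ` {g \<in> embeddings (A - {a}) E V R. \<forall>b\<in>nbrs E A a. g b = u})"
    (is "?L = ?M \<union> ?N")
proof (intro equalityI subsetI)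
  fix f assume f: "f \<in> ?L"
  have edge: "(f a, f b) \<in> {(u, w), (w, u)} \<union> R" if "a \<in> A" "b \<in> A" "(a, b) \<in> E" for a b
    using f that by (auto simp: embeddings_def)
  show "f \<in> ?M \<union> ?N"
  proof (cases "w \<in> f ` A")
    case False
    then have "f \<in> A \<rightarrow>\<^sub>E V" using f by (auto simp: embeddings_def PiE_iff)
    moreover have "(f a, f b) \<in> R" if "a \<in> A" "b \<in> A" "(a, b) \<in> E" for a b
      using edge[OF that] False that by (auto simp: image_iff)
    ultimately show ?thesis using f by (auto simp: embeddings_def)
  next
    case True
    then obtain a where a: "a \<in> A" "f a = w" by blast
    have ne: "f b \<noteq> w" if "b \<in> A" "b \<noteq> a" for b
      using f a that by (auto simp: embeddings_def inj_on_def)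
    \<comment> \<open>Resetting the value to \<open>undefined\<close> makes \<open>g\<close>
      extensional on \<open>A - {a}\<close>.\<close>
    define g where "g = f(a := undefined)"
    have fg: "f = g(a := w)" using a by (auto simp: g_def)
    have "g \<in> (A - {a}) \<rightarrow>\<^sub>E V"
      using f ne by (auto simp: embeddings_def g_def PiE_iff extensional_def)
    moreover have "inj_on g (A - {a})"
      using f by (auto simp: embeddings_def g_def inj_on_def)
    moreover have "(g b, g c) \<in> R" if "b \<in> A - {a}" "c \<in> A - {a}" "(b, c) \<in> E" for b c
      using edge[of b c] that ne[of b] ne[of c] by (auto simp: g_def)
    ultimately have "g \<in> embeddings (A - {a}) E V R" by (auto simp: embeddings_def)
    moreover have "g b = u" if b: "b \<in> nbrs E A a" for b
    proof -
      have "b \<noteq> a" "b \<in> A" using E b by (auto simp: nbrs_def irrefl_def)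
      then show ?thesis
        using edge[of a b] edge[of b a] b a R w by (auto simp: nbrs_def g_def)
    qed
    ultimately have "f \<in> ?N" using a fg by blast
    then show ?thesis by blast
  qed
next
  fix f assume "f \<in> ?M \<union> ?N"
  then show "f \<in> ?L"
  proof
    assume "f \<in> ?M"
    then show ?thesis by (auto simp: embeddings_def PiE_iff)
  next
    assume "f \<in> ?N"
    then obtain a g where a: "a \<in> A" and f: "f = g(a := w)"
      and g: "g \<in> embeddings (A - {a}) E V R" and nb: "\<And>b. b \<in> nbrs E A a \<Longrightarrow> g b = u"
      by blast
    have "f \<in> A \<rightarrow>\<^sub>E insert w V"
      using g a by (auto simp: embeddings_def f PiE_iff extensional_def)
    moreover have "inj_on f A"
      using g w by (auto simp: embeddings_def f PiE_iff inj_on_def)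
    moreover have "(f b, f c) \<in> {(u, w), (w, u)} \<union> R" if bc: "b \<in> A" "c \<in> A" "(b, c) \<in> E" for b c
    proof -
      have "b \<noteq> c" using E bc by (auto simp: irrefl_def)
      then consider "b = a" "c \<noteq> a" | "b \<noteq> a" "c = a" | "b \<noteq> a" "c \<noteq> a" by blast
      then show ?thesis
      proof cases
        case 1 then show ?thesis using bc nb[of c] by (auto simp: f nbrs_def)
      next
        case 2 then show ?thesis using bc nb[of b] by (auto simp: f nbrs_def)
      next
        case 3 then show ?thesis using bc g by (auto simp: f embeddings_def)
      qed
    qed
    ultimately show ?thesis by (auto simp: embeddings_def)
  qed
qed

text \<open>The pieces of \<open>embeddings_insert\<close> are pairwise disjoint because the
  preimage of \<open>w\<close> tells them apart, and \<open>g\<close> is recovered from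
  \<open>g(a := w)\<close> since its value at \<open>a\<close> is \<open>undefined\<close>.\<close>

lemma emb_sum_insert:
  assumes "finite A" "finite V" "w \<notin> V" "u \<in> V" "R \<subseteq> V \<times> V" "irrefl E"
  shows "emb_sum (insert w V) x ({(u, w), (w, u)} \<union> R) A E l = emb_sum V x R A E l +
    (\<Sum>a\<in>A. pochhammer (x w) (l a) *
      (\<Sum>g | g \<in> embeddings (A - {a}) E V R \<and> (\<forall>b\<in>nbrs E A a. g b = u).
        wt V x (load (A - {a}) l g)))"
proof -
  define N where "N a = {g \<in> embeddings (A - {a}) E V R. \<forall>b\<in>nbrs E A a. g b = u}" for a
  let ?I = "\<lambda>a. (\<lambda>g. g(a := w)) ` N a"
  let ?w = "\<lambda>f. wt (insert w V) x (load A l f)"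
  have fin: "finite (N a)" for a
    unfolding N_def using finite_embeddings[of "A - {a}" V E R] assms by simp
  have off: "f a \<noteq> w" if "f \<in> embeddings B E V R" "a \<in> B" for f a B
    using that assms(3) by (auto simp: embeddings_def PiE_iff)
  have disj: "?I a \<inter> ?I b = {}" if "a \<in> A" "b \<in> A" "a \<noteq> b" for a b
  proof -
    have "f b \<noteq> w" if "f \<in> ?I a" for f
      using that off[of _ "A - {a}" b] \<open>a \<noteq> b\<close> \<open>b \<in> A\<close> by (auto simp: N_def)
    moreover have "f b = w" if "f \<in> ?I b" for f using that by auto
    ultimately show ?thesis by blast
  qed
  have disj': "embeddings A E V R \<inter> (\<Union>a\<in>A. ?I a) = {}"
    using off[of _ A] by fastforce
  have old: "?w f = wt V x (load A l f)" if "f \<in> embeddings A E V R" for f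
  proof -
    have "{a \<in> A. f a = w} = {}" using off[OF that] by blast
    then have "load A l f w = 0" by (metis load_def sum.empty)
    then show ?thesis using assms by (simp add: wt_insert)
  qed
  have new: "sum ?w (?I a) = pochhammer (x w) (l a) * (\<Sum>g\<in>N a. wt V x (load (A - {a}) l g))"
    if a: "a \<in> A" for a
  proof -
    have inj: "inj_on (\<lambda>g. g(a := w)) (N a)"
    proof (rule inj_onI)
      fix g h assume gh: "g \<in> N a" "h \<in> N a" "g(a := w) = h(a := w)"
      have "g a = undefined" "h a = undefined"
        using gh by (auto simp: N_def embeddings_def PiE_iff extensional_def)
      then show "g = h" using gh(3) by (metis fun_upd_triv fun_upd_upd)
    qed
    have eq: "?w (g(a := w)) = pochhammer (x w) (l a) * wt V x (load (A - {a}) l g)"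
      if g: "g \<in> N a" for g
    proof -
      have "{b \<in> A. (g(a := w)) b = w} = {a}"
        using a g off[of g "A - {a}"] by (auto simp: N_def)
      then have "load A l (g(a := w)) w = l a" by (simp add: load_def)
      moreover have "load A l (g(a := w)) v = load (A - {a}) l g v" if "v \<in> V" for v
        unfolding load_def by (rule sum.cong) (use that assms(3) in auto)
      ultimately show ?thesis using assms by (simp add: wt_insert cong: wt_cong)
    qed
    show ?thesis
      unfolding sum.reindex[OF inj] sum_distrib_left by (rule sum.cong) (auto simp: eq)
  qed
  have "emb_sum (insert w V) x ({(u, w), (w, u)} \<union> R) A E l
    = sum ?w (embeddings A E V R) + sum ?w (\<Union>a\<in>A. ?I a)"
    unfolding emb_sum_def embeddings_insert[OF assms(3-6)] N_def[symmetric]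
    by (rule sum.union_disjoint) (use assms fin disj' in \<open>auto simp: finite_embeddings\<close>)
  also have "sum ?w (embeddings A E V R) = emb_sum V x R A E l"
    unfolding emb_sum_def by (rule sum.cong) (auto simp: old)
  also have "sum ?w (\<Union>a\<in>A. ?I a) = (\<Sum>a\<in>A. sum ?w (?I a))"
    by (rule sum.UNION_disjoint) (use assms fin disj in auto)
  also have "\<dots> = (\<Sum>a\<in>A. pochhammer (x w) (l a) * (\<Sum>g\<in>N a. wt V x (load (A - {a}) l g)))"
    by (rule sum.cong) (auto simp: new)
  finally show ?thesis by (simp add: N_def)
qed

text \<open>
  The contribution of the embeddings sending \<open>a\<close> to the new leaf, which has a single neighbour: such
  embeddings exist only if \<open>a\<close> has at most one neighbour \<open>p\<close>, and then the new leaf was attached to the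
  image of \<open>p\<close>, whose selection probability raises the exponent at \<open>p\<close> by one.
\<close>

definition pruned_sum ::
  "'v set \<Rightarrow> ('v \<Rightarrow> real) \<Rightarrow> 'v rel \<Rightarrow> 'p set \<Rightarrow> 'p rel \<Rightarrow> ('p \<Rightarrow> nat) \<Rightarrow> 'p \<Rightarrow> real" where
  "pruned_sum V x R A E l a =
     (if nbrs E A a = {} then (sum x V + real (sum l (A - {a}))) * emb_sum V x R (A - {a}) E l
      else if is_singleton (nbrs E A a)
      then let p = the_elem (nbrs E A a) in emb_sum V x R (A - {a}) E (l(p := Suc (l p)))
      else 0)"

lemma sum_pruned:
  assumes "finite A" "finite V" "a \<in> A" "irrefl E"
  shows "(\<Sum>u\<in>V. x u * (\<Sum>g | g \<in> embeddings (A - {a}) E V R \<and> (\<forall>b\<in>nbrs E A a. g b = u).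
            wt V (x(u := x u + 1)) (load (A - {a}) l g))) = pruned_sum V x R A E l a"
proof -
  let ?B = "A - {a}" and ?E = "embeddings (A - {a}) E V R" and ?N = "nbrs E A a"
  let ?y = "\<lambda>u. x(u := x u + 1)"
  have fin: "finite ?E" using assms by (simp add: finite_embeddings)
  have N: "?N \<subseteq> ?B" using assms(4) by (auto simp: nbrs_def irrefl_def)
  have im: "g ` ?B \<subseteq> V" "inj_on g ?B" if "g \<in> ?E" for g
    using that by (auto simp: embeddings_def PiE_iff)
  have "(\<Sum>u\<in>V. x u * (\<Sum>g | g \<in> ?E \<and> (\<forall>b\<in>?N. g b = u). wt V (?y u) (load ?B l g)))
    = (\<Sum>u\<in>V. \<Sum>g\<in>?E. if \<forall>b\<in>?N. g b = u then x u * wt V (?y u) (load ?B l g) else 0)"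
    by (auto simp: sum_distrib_left sum.inter_filter fin intro!: sum.cong)
  \<comment> \<open>For a fixed \<open>g\<close> the condition on \<open>u\<close> in the inner sum
    is now void, forces a single vertex, or cannot be satisfied.\<close>
  also have "\<dots> = (\<Sum>g\<in>?E. \<Sum>u\<in>V. if \<forall>b\<in>?N. g b = u then x u * wt V (?y u) (load ?B l g) else 0)"
    by (rule sum.swap)
  also have "\<dots> = pruned_sum V x R A E l a"
  proof -
    consider "?N = {}" | p where "?N = {p}" | "?N \<noteq> {}" "\<not> is_singleton ?N"
      by (metis is_singleton_def)
    then show ?thesis
    proof cases
      case 1
      have "(\<Sum>u\<in>V. x u * wt V (?y u) (load ?B l g)) = (sum x V + real (sum l ?B)) * wt V x (load ?B l g)"
        if "g \<in> ?E" for g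
        by (subst sum_wt_raise, simp add: assms, subst sum_load) (use assms im[OF that] in auto)
      then show ?thesis by (simp add: 1 pruned_sum_def emb_sum_def sum_distrib_left)
    next
      case 2
      let ?l = "l(p := Suc (l p))"
      have p: "p \<in> ?B" using N 2 by blast
      have "(\<Sum>u\<in>V. if g p = u then x u * wt V (?y u) (load ?B l g) else 0) = wt V x (load ?B ?l g)"
        if g: "g \<in> ?E" for g
      proof -
        have gp: "g p \<in> V" using im[OF g] p by blast
        \<comment> \<open>As \<open>g\<close> is injective, only \<open>p\<close> lies over
          \<open>g p\<close>, so raising the exponent of \<open>p\<close> raises the load of that
          one vertex.\<close>
        have "load ?B ?l g v = ((load ?B l g)(g p := Suc (load ?B l g (g p)))) v" for v
        proof (cases "v = g p")
          case True
          have "{b \<in> ?B. g b = g p} = {p}" using im(2)[OF g] p by (auto simp: inj_on_def)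
          then have "load ?B l' g (g p) = l' p" for l' by (simp add: load_def)
          then show ?thesis by (simp add: True)
        next
          case False
          then show ?thesis unfolding load_def by (simp, intro sum.cong) auto
        qed
        then have "wt V x (load ?B ?l g) = x (g p) * wt V (?y (g p)) (load ?B l g)"
          using wt_raise_load[OF assms(2) gp, of x "load ?B l g"] by (metis wt_cong)
        then show ?thesis using assms gp by simp
      qed
      then show ?thesis by (simp add: 2 pruned_sum_def emb_sum_def)
    next
      case 3
      then obtain b c where bc: "b \<in> ?N" "c \<in> ?N" "b \<noteq> c"
        by (metis is_singletonI' )
      have "\<not> (\<forall>b\<in>?N. g b = u)" if "g \<in> ?E" for g u
        using im(2)[OF that] bc N by (metis inj_onD subsetD)
      then have "(\<Sum>g\<in>?E. \<Sum>u\<in>V. if \<forall>b\<in>?N. g b = u then x u * wt V (?y u) (load ?B l g) else 0)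
        = (\<Sum>g\<in>?E. \<Sum>u\<in>V. 0)"
        by (intro sum.cong refl if_not_P) blast
      then show ?thesis using 3 by (simp add: pruned_sum_def)
    qed
  qed
  finally show ?thesis .
qed

text \<open>Embeddings missing the leaf give the leading term by \<open>sum_wt_raise\<close>, those
  through the leaf are evaluated by \<open>sum_pruned\<close>. The system is triangular in the
  number of pattern vertices.\<close>

lemma emb_sum_step:
  assumes "finite A" "finite V" "w \<notin> V" "R \<subseteq> V \<times> V" "irrefl E"
  shows "(\<Sum>u\<in>V. x u * emb_sum (insert w V) (x(u := x u + 1, w := \<alpha>)) ({(u, w), (w, u)} \<union> R) A E l)
    = (sum x V + real (sum l A)) * emb_sum V x R A E l
      + (\<Sum>a\<in>A. pochhammer \<alpha> (l a) * pruned_sum V x R A E l a)"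
proof -
  let ?y = "\<lambda>u. x(u := x u + 1)"
  have eq: "wt V (x(u := x u + 1, w := \<alpha>)) m = wt V (?y u) m" for u m
    by (intro wt_cong) (use assms in auto)
  let ?Q = "\<lambda>u a. (\<Sum>g | g \<in> embeddings (A - {a}) E V R \<and> (\<forall>b\<in>nbrs E A a. g b = u).
            wt V (?y u) (load (A - {a}) l g))"
  have main: "(\<Sum>u\<in>V. x u * emb_sum V (?y u) R A E l) = (sum x V + real (sum l A)) * emb_sum V x R A E l"
  proof -
    have "(\<Sum>u\<in>V. x u * emb_sum V (?y u) R A E l)
      = (\<Sum>f\<in>embeddings A E V R. \<Sum>u\<in>V. x u * wt V (?y u) (load A l f))"
      unfolding emb_sum_def sum_distrib_left by (rule sum.swap)
    also have "\<dots> = (\<Sum>f\<in>embeddings A E V R. (sum x V + real (sum l A)) * wt V x (load A l f))"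
      by (intro sum.cong refl, subst sum_wt_raise, simp add: assms, subst sum_load)
         (use assms in \<open>auto simp: embeddings_def PiE_iff\<close>)
    finally show ?thesis by (simp add: emb_sum_def sum_distrib_left)
  qed
  have "(\<Sum>u\<in>V. x u * emb_sum (insert w V) (x(u := x u + 1, w := \<alpha>)) ({(u, w), (w, u)} \<union> R) A E l)
    = (\<Sum>u\<in>V. x u * (emb_sum V (?y u) R A E l + (\<Sum>a\<in>A. pochhammer \<alpha> (l a) * ?Q u a)))"
    by (intro sum.cong refl, subst emb_sum_insert) (use assms in \<open>auto simp: eq emb_sum_def\<close>)
  also have "\<dots> = (\<Sum>u\<in>V. x u * emb_sum V (?y u) R A E l)
      + (\<Sum>u\<in>V. \<Sum>a\<in>A. pochhammer \<alpha> (l a) * (x u * ?Q u a))"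
    by (simp add: distrib_left sum.distrib sum_distrib_left mult_ac)
  also have "(\<Sum>u\<in>V. \<Sum>a\<in>A. pochhammer \<alpha> (l a) * (x u * ?Q u a))
      = (\<Sum>a\<in>A. pochhammer \<alpha> (l a) * (\<Sum>u\<in>V. x u * ?Q u a))"
    unfolding sum_distrib_left by (rule sum.swap)
  also have "\<dots> = (\<Sum>a\<in>A. pochhammer \<alpha> (l a) * pruned_sum V x R A E l a)"
    by (intro sum.cong refl) (use assms in \<open>simp add: sum_pruned\<close>)
  finally show ?thesis unfolding main .
qed

section \<open>Domination of squared embedding sums\<close>

lemma emb_sum_nonneg: "(\<And>v. v \<in> V \<Longrightarrow> 0 < x v) \<Longrightarrow> 0 \<le> emb_sum V x R A E l"
  unfolding emb_sum_def by (intro sum_nonneg less_imp_le wt_pos)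

lemma emb_sum_le_all_sum:
  assumes "finite A" "finite V" "\<And>v. v \<in> V \<Longrightarrow> 0 < x v"
  shows "emb_sum V x R A E l \<le> all_sum V x A l"
  unfolding emb_sum_def all_sum_def
  by (rule sum_mono2)
     (use assms in \<open>auto simp: embeddings_def intro!: finite_PiE less_imp_le[OF wt_pos]\<close>)

lemma load_Plus:
  assumes "finite A" "finite B"
  shows "load (A <+> B) (case_sum l m) (case_sum f g) v = load A l f v + load B m g v"
proof -
  have "{s \<in> A <+> B. case_sum f g s = v} = {a \<in> A. f a = v} <+> {b \<in> B. g b = v}" by auto
  then show ?thesis using assms unfolding load_def by (simp add: sum.Plus)
qed

text \<open>A pair of maps is a single map on the disjoint union, and its loads add. By
  \<open>wt_mult_le\<close> merging the loads can only increase the weight.\<close>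

lemma all_sum_mult_le:
  fixes V :: "'v set" and A :: "'p set" and B :: "'q set"
  assumes "finite A" "finite B" "finite V" "\<And>v. v \<in> V \<Longrightarrow> 0 < x v"
  shows "all_sum V x A l * all_sum V x B m \<le> all_sum V x (A <+> B) (case_sum l m)"
proof -
  have "all_sum V x A l * all_sum V x B m
    = (\<Sum>(f, g)\<in>(A \<rightarrow>\<^sub>E V) \<times> (B \<rightarrow>\<^sub>E V). wt V x (load A l f) * wt V x (load B m g))"
    unfolding all_sum_def by (simp add: sum_product sum.cartesian_product)
  also have "\<dots> \<le> (\<Sum>(f, g)\<in>(A \<rightarrow>\<^sub>E V) \<times> (B \<rightarrow>\<^sub>E V).
      wt V x (load (A <+> B) (case_sum l m) (case_sum f g)))"
  proof (intro sum_mono, clarify)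
    fix f :: "'p \<Rightarrow> 'v" and g :: "'q \<Rightarrow> 'v"
    have "load (A <+> B) (case_sum l m) (case_sum f g) = (\<lambda>v. load A l f v + load B m g v)"
      using assms by (intro ext load_Plus)
    then show "wt V x (load A l f) * wt V x (load B m g)
        \<le> wt V x (load (A <+> B) (case_sum l m) (case_sum f g))"
      using wt_mult_le[of V x "load A l f" "load B m g"] assms by simp
  qed
  also have "\<dots> = all_sum V x (A <+> B) (case_sum l m)"
    unfolding all_sum_def
    by (rule sum.reindex_bij_witness[of _ "\<lambda>h. (h \<circ> Inl, h \<circ> Inr)" "\<lambda>(f, g). case_sum f g"])
       (auto simp: PiE_iff extensional_def fun_eq_iff case_sum_o_inj split: sum.splits)
  finally show ?thesis .
qed

text \<open>Two embeddings may overlap, so a pair of them need not embed the disjoint union of the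
  patterns. Forgetting injectivity and edges first leads to sums in which overlaps are
  allowed.\<close>

lemma emb_sum_power2_le:
  assumes "finite A" "finite V" "\<And>v. v \<in> V \<Longrightarrow> 0 < x v"
  shows "(emb_sum V x R A E l)\<^sup>2 \<le> all_sum V x (A <+> A) (case_sum l l)"
proof -
  have "(emb_sum V x R A E l)\<^sup>2 \<le> (all_sum V x A l)\<^sup>2"
    using assms by (intro power_mono emb_sum_le_all_sum emb_sum_nonneg)
  also have "\<dots> \<le> all_sum V x (A <+> A) (case_sum l l)"
    unfolding power2_eq_square using assms by (intro all_sum_mult_le)
  finally show ?thesis .
qed

section \<open>Invariance of embedding sums under isomorphism\<close>

lemma bij_betw_embeddings:
  assumes h: "bij_betw h V V'" and RV: "R \<subseteq> V \<times> V" and R': "R' = map_prod h h ` R"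
  shows "bij_betw (\<lambda>f. restrict (h \<circ> f) A) (embeddings A E V R) (embeddings A E V' R')"
proof (rule bij_betw_byWitness[where f' = "\<lambda>f. restrict (the_inv_into V h \<circ> f) A"])
  let ?k = "the_inv_into V h"
  have inj: "inj_on h V" and im: "h ` V = V'" using h by (auto simp: bij_betw_def)
  have kh: "?k (h v) = v" if "v \<in> V" for v using inj that by (rule the_inv_into_f_f)
  have hk: "h (?k v) = v" if "v \<in> V'" for v using inj im that by (auto intro: f_the_inv_into_f)
  have kV: "?k v \<in> V" if "v \<in> V'" for v using inj im that kh by auto
  have arc: "(h u, h v) \<in> R' \<longleftrightarrow> (u, v) \<in> R" if "u \<in> V" "v \<in> V" for u v
  proof
    assume "(h u, h v) \<in> R'"
    then obtain u' v' where "(u', v') \<in> R" "h u = h u'" "h v = h v'" using R' by auto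
    then show "(u, v) \<in> R" using RV inj that by (metis SigmaD1 SigmaD2 inj_onD subsetD)
  next
    assume "(u, v) \<in> R"
    then show "(h u, h v) \<in> R'" unfolding R' by (metis map_prod_imageI)
  qed
  show "\<forall>f\<in>embeddings A E V R. restrict (?k \<circ> restrict (h \<circ> f) A) A = f"
    by (auto simp: embeddings_def fun_eq_iff PiE_iff extensional_def restrict_def kh)
  show "\<forall>f\<in>embeddings A E V' R'. restrict (h \<circ> restrict (?k \<circ> f) A) A = f"
    by (auto simp: embeddings_def fun_eq_iff PiE_iff extensional_def restrict_def hk)
  show "(\<lambda>f. restrict (h \<circ> f) A) ` embeddings A E V R \<subseteq> embeddings A E V' R'"
    using im inj arc by (auto simp: embeddings_def PiE_iff inj_on_def)
  show "(\<lambda>f. restrict (?k \<circ> f) A) ` embeddings A E V' R' \<subseteq> embeddings A E V R"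
  proof -
    have "(?k u, ?k v) \<in> R" if "u \<in> V'" "v \<in> V'" "(u, v) \<in> R'" for u v
      using arc[of "?k u" "?k v"] that by (simp add: kV hk)
    moreover have "u = v" if "u \<in> V'" "v \<in> V'" "?k u = ?k v" for u v
      using that hk by metis
    ultimately show ?thesis by (auto simp: embeddings_def PiE_iff inj_on_def kV)
  qed
qed

lemma wt_bij_betw:
  assumes h: "bij_betw h V V'" and f: "f ` A \<subseteq> V" and x: "\<And>v. v \<in> V \<Longrightarrow> x' (h v) = x v"
  shows "wt V' x' (load A l (h \<circ> f)) = wt V x (load A l f)"
proof -
  have "load A l (h \<circ> f) (h v) = load A l f v" if "v \<in> V" for v
  proof -
    have "{a \<in> A. (h \<circ> f) a = h v} = {a \<in> A. f a = v}"
      using h f that by (auto simp: bij_betw_def inj_on_def)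
    then show ?thesis by (simp add: load_def)
  qed
  then show ?thesis
    unfolding wt_def prod.reindex_bij_betw[OF h, symmetric] using x by simp
qed

lemma emb_sum_bij_betw:
  assumes h: "bij_betw h V V'" and RV: "R \<subseteq> V \<times> V" and R': "R' = map_prod h h ` R"
    and x: "\<And>v. v \<in> V \<Longrightarrow> x' (h v) = x v"
  shows "emb_sum V' x' R' A E l = emb_sum V x R A E l"
proof -
  have "emb_sum V' x' R' A E l
    = (\<Sum>f\<in>embeddings A E V R. wt V' x' (load A l (restrict (h \<circ> f) A)))"
    unfolding emb_sum_def by (rule sum.reindex_bij_betw[OF bij_betw_embeddings[OF h RV R'], symmetric])
  also have "\<dots> = emb_sum V x R A E l"
    unfolding emb_sum_def
  proof (rule sum.cong[OF refl])
    fix f assume "f \<in> embeddings A E V R"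
    then have f: "f ` A \<subseteq> V" by (auto simp: embeddings_def PiE_iff)
    have "load A l (restrict (h \<circ> f) A) = load A l (h \<circ> f)" by (rule load_cong) simp
    then show "wt V' x' (load A l (restrict (h \<circ> f) A)) = wt V x (load A l f)"
      by (simp add: wt_bij_betw[OF h f, of x' x] x)
  qed
  finally show ?thesis .
qed

section \<open>Growth factors\<close>

text \<open>Solves \<open>Z n * y (Suc n) = (Z n + s) * y n\<close> from the value \<open>1\<close>
  at \<open>k\<close>. For \<open>Z = total_fitness \<alpha>\<close> it is of order
  \<open>n powr (s / (1 + \<alpha>))\<close>, so an exponent above \<open>1 + \<alpha>\<close> means
  faster than linear growth.\<close>

definition growth :: "(nat \<Rightarrow> real) \<Rightarrow> nat \<Rightarrow> real \<Rightarrow> nat \<Rightarrow> real" where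
  "growth Z k s n = (\<Prod>i=k..<n. 1 + s / Z i)"

lemma growth_Suc: "k \<le> n \<Longrightarrow> growth Z k s (Suc n) = growth Z k s n * (1 + s / Z n)"
  by (simp add: growth_def)

lemma growth_start [simp]: "growth Z k s k = 1"
  by (simp add: growth_def)

lemma growth_pos:
  assumes "\<And>i. k \<le> i \<Longrightarrow> 0 < Z i" "0 \<le> s"
  shows "0 < growth Z k s n"
  unfolding growth_def by (intro prod_pos) (auto intro!: add_pos_nonneg divide_nonneg_pos assms)

text \<open>Each factor of the product on the right exceeds the one on the left by
  \<open>s * t / (Z i * Z i)\<close>.\<close>

lemma growth_add_le:
  assumes Z: "\<And>i. k \<le> i \<Longrightarrow> 0 < Z i" and "0 \<le> s" "0 \<le> t"
  shows "growth Z k (s + t) n \<le> growth Z k s n * growth Z k t n"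
  unfolding growth_def prod.distrib[symmetric]
proof (intro prod_mono conjI)
  fix i assume "i \<in> {k..<n}"
  then have "0 < Z i" using Z by simp
  then show "1 + (s + t) / Z i \<le> (1 + s / Z i) * (1 + t / Z i)" "0 \<le> 1 + (s + t) / Z i"
    using assms by (simp_all add: algebra_simps add_divide_distrib)
qed

text \<open>With \<open>w\<close> the ratio of growth factors, \<open>(Z i + a) * w i\<close> decreases by at least \<open>(j - c) * w i\<close>
  in each step.\<close>

lemma sum_growth_ratio_le:
  assumes Z: "\<And>i. k \<le> i \<Longrightarrow> 0 < Z i" and step: "\<And>i. Z (Suc i) = Z i + c"
    and c: "0 \<le> c" "c < j" "j \<le> a"
  shows "(\<Sum>i=k..<n. growth Z k (a - j) i / growth Z k a i) \<le> (Z k + a) / (j - c)"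
proof (cases "k \<le> n")
  case True
  define w where "w i = growth Z k (a - j) i / growth Z k a i" for i
  have w: "0 \<le> w i" for i
    unfolding w_def using growth_pos[of k Z "a - j" i, OF Z] growth_pos[of k Z a i, OF Z] c
    by (simp add: less_imp_le)
  have "(j - c) * (\<Sum>i=k..<n. w i) \<le> (Z k + a) - (Z n + a) * w n"
    using True
  proof (induction n rule: dec_induct)
    case base
    then show ?case by (simp add: w_def)
  next
    case (step i)
    let ?Y = "Z i + a"
    have Zi: "0 < Z i" using Z step by simp
    then have Y: "0 < ?Y" using c by simp
    have "w (Suc i) = w i * ((1 + (a - j) / Z i) / (1 + a / Z i))"
      using step by (simp add: w_def growth_Suc)
    also have "(1 + (a - j) / Z i) / (1 + a / Z i) = (?Y - j) / ?Y"
      using Zi Y by (simp add: divide_simps)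
    finally have wS: "w (Suc i) = w i * ((?Y - j) / ?Y)" .
    have "(?Y + c) * ((?Y - j) / ?Y) \<le> ?Y - (j - c)"
    proof -
      have "(?Y + c) * (?Y - j) \<le> (?Y - (j - c)) * ?Y"
        using c mult_nonneg_nonneg[of c j] by (simp add: algebra_simps)
      then show ?thesis using Y by (simp add: pos_divide_le_eq)
    qed
    then have "w i * ((?Y + c) * ((?Y - j) / ?Y)) \<le> w i * (?Y - (j - c))"
      using w by (rule mult_left_mono)
    then have "(Z (Suc i) + a) * w (Suc i) \<le> ?Y * w i - (j - c) * w i"
      by (simp add: wS assms(2) algebra_simps)
    then show ?case using step by (simp add: algebra_simps)
  qed
  also have "\<dots> \<le> Z k + a"
    using w[of n] Z[of n] True c by simp
  finally show ?thesis using c by (simp add: w_def pos_le_divide_eq mult.commute)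
next
  case False
  then show ?thesis using Z[of k] c by (simp add: divide_nonneg_pos)
qed

text \<open>A discrete Gronwall estimate. After division by \<open>growth Z k a\<close>, a step of
  \<open>h\<close> adds at most multiples of ratios of growth factors, and the gap
  \<open>c < a - b J\<close> makes these summable by \<open>sum_growth_ratio_le\<close>.\<close>

lemma growth_domination:
  assumes Z: "\<And>i. k \<le> i \<Longrightarrow> 0 < Z i" and step: "\<And>i. Z (Suc i) = Z i + c" and c: "0 \<le> c"
    and fin: "finite I"
    and b: "\<And>J. J \<in> I \<Longrightarrow> 0 \<le> b J \<and> c < a - b J"
    and p: "\<And>J. J \<in> I \<Longrightarrow> 0 \<le> p J"
    and g: "\<And>J. J \<in> I \<Longrightarrow> \<exists>C. \<forall>i\<ge>k. g J i \<le> C * growth Z k (b J) i"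
    and a: "0 \<le> a"
    and rec: "\<And>i. k \<le> i \<Longrightarrow>
      Z i * h (Suc i) \<le> (Z i + a) * h i + (\<Sum>J\<in>I. p J * ((Z i + b J) * g J i))"
  shows "\<exists>C. \<forall>n\<ge>k. h n \<le> C * growth Z k a n"
proof -
  obtain C where C: "\<And>J i. J \<in> I \<Longrightarrow> k \<le> i \<Longrightarrow> g J i \<le> C J * growth Z k (b J) i"
    using g by metis
  define w where "w J i = growth Z k (b J) i / growth Z k a i" for J i
  have Ga: "0 < growth Z k a i" for i using Z a by (rule growth_pos)
  \<comment> \<open>The factor \<open>1 + b J / Z n\<close> of the recursion advances
    \<open>growth Z k (b J)\<close> from \<open>n\<close> to \<open>Suc n\<close>, hence the shifted
    index of \<open>w\<close>.\<close>
  have "h n / growth Z k a n \<le> h k + (\<Sum>J\<in>I. p J * C J * (\<Sum>i=k..<n. w J (Suc i)))"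
    if "k \<le> n" for n
    using that
  proof (induction n rule: dec_induct)
    case base
    then show ?case by simp
  next
    case (step n)
    have Zn: "0 < Z n" using Z step by simp
    have "h (Suc n) \<le> ((Z n + a) * h n + (\<Sum>J\<in>I. p J * ((Z n + b J) * g J n))) / Z n"
      using rec[of n] Zn step by (simp add: pos_le_divide_eq mult.commute)
    also have "\<dots> = (1 + a / Z n) * h n + (\<Sum>J\<in>I. p J * ((1 + b J / Z n) * g J n))"
      using Zn by (simp add: add_divide_distrib sum_divide_distrib distrib_right distrib_left)
    also have "(\<Sum>J\<in>I. p J * ((1 + b J / Z n) * g J n))
        \<le> (\<Sum>J\<in>I. p J * ((1 + b J / Z n) * (C J * growth Z k (b J) n)))"
      using step Zn b by (intro sum_mono mult_left_mono C p) (auto intro!: add_nonneg_nonneg)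
    also have "\<dots> = (\<Sum>J\<in>I. p J * C J * growth Z k (b J) (Suc n))"
      using step by (simp add: growth_Suc mult_ac)
    finally have "h (Suc n) / growth Z k a (Suc n) \<le>
        ((1 + a / Z n) * h n + (\<Sum>J\<in>I. p J * C J * growth Z k (b J) (Suc n))) / growth Z k a (Suc n)"
      using Ga by (simp add: divide_right_mono less_imp_le)
    also have "\<dots> = h n / growth Z k a n + (\<Sum>J\<in>I. p J * C J * w J (Suc n))"
    proof -
      have "(1 + a / Z n) * h n / growth Z k a (Suc n) = h n / growth Z k a n"
        using step Zn a by (simp add: growth_Suc add_pos_nonneg less_imp_neq[symmetric])
      then show ?thesis by (simp add: add_divide_distrib sum_divide_distrib w_def)
    qed
    finally show ?case
      using step.IH step.hyps by (simp add: sum.distrib distrib_left)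
  qed
  \<comment> \<open>The constant \<open>C J\<close> may be negative, so its absolute value is taken
    before the sum is bounded.\<close>
  moreover have "p J * C J * (\<Sum>i=k..<n. w J (Suc i)) \<le> p J * \<bar>C J\<bar> * ((Z k + a) / (a - b J - c))"
    if J: "J \<in> I" and n: "k \<le> n" for J n
  proof -
    have w: "0 \<le> w J i" for i
      unfolding w_def using growth_pos[of k Z "b J" i, OF Z] Ga[of i] b[OF J] by (simp add: less_imp_le)
    have "(\<Sum>i=k..<n. w J (Suc i)) = (\<Sum>i=Suc k..<Suc n. w J i)"
      by (rule sum.shift_bounds_Suc_ivl[symmetric])
    also have "\<dots> \<le> (\<Sum>i=k..<Suc n. w J i)" by (intro sum_mono2) (auto simp: w)
    also have "\<dots> \<le> (Z k + a) / (a - b J - c)"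
      using sum_growth_ratio_le[of k Z c "a - b J" a "Suc n", OF Z step c] b[OF J] by (simp add: w_def)
    finally show ?thesis
      using p[OF J] w by (intro mult_mono mult_left_mono) (auto intro!: sum_nonneg)
  qed
  ultimately have "h n / growth Z k a n \<le> h k + (\<Sum>J\<in>I. p J * \<bar>C J\<bar> * ((Z k + a) / (a - b J - c)))"
    if "k \<le> n" for n
    using that by (smt (verit) sum_mono)
  then show ?thesis using Ga by (metis pos_divide_le_eq)
qed

section \<open>Total variation distance\<close>

lemma tv_dist_ge: "\<bar>measure_pmf.prob p A - measure_pmf.prob q A\<bar> \<le> tv_dist p q"
  unfolding tv_dist_def
proof (rule cSUP_upper)
  have "\<bar>measure_pmf.prob p B - measure_pmf.prob q B\<bar> \<le> 1" for B
    using measure_pmf.prob_le_1[of p B] measure_pmf.prob_le_1[of q B]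
      measure_nonneg[of p B] measure_nonneg[of q B] by linarith
  then show "bdd_above (range (\<lambda>A. \<bar>measure_pmf.prob p A - measure_pmf.prob q A\<bar>))"
    by (auto simp: bdd_above_def)
qed simp

lemma tv_dist_nonneg: "0 \<le> tv_dist p q"
  using tv_dist_ge[of p "{}" q] by simp

lemma tv_dist_commute: "tv_dist p q = tv_dist q p"
  by (simp add: tv_dist_def abs_minus_commute)

lemma expectation_diff:
  fixes f :: "'x \<Rightarrow> real"
  assumes "finite U" "set_pmf p \<subseteq> U" "set_pmf q \<subseteq> U"
  shows "measure_pmf.expectation p f - measure_pmf.expectation q f = (\<Sum>x\<in>U. f x * (pmf p x - pmf q x))"
  using assms by (subst (1 2) integral_measure_pmf_real[of U])
    (auto simp: sum_subtractf right_diff_distrib)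

text \<open>Among test functions with values between 0 and 1 the difference is largest for the
  indicator of the points where \<open>p\<close> has at least the mass of \<open>q\<close>.\<close>

lemma expectation_diff_le_tv_dist:
  fixes f :: "'x \<Rightarrow> real"
  assumes p: "finite (set_pmf p)" and q: "finite (set_pmf q)"
    and f: "\<And>x. x \<in> set_pmf p \<union> set_pmf q \<Longrightarrow> 0 \<le> f x \<and> f x \<le> 1"
  shows "measure_pmf.expectation p f - measure_pmf.expectation q f \<le> tv_dist p q"
proof -
  let ?U = "set_pmf p \<union> set_pmf q" and ?d = "\<lambda>x. pmf p x - pmf q x"
  let ?P = "{x \<in> ?U. 0 \<le> ?d x}"
  have U: "finite ?U" using p q by simp
  have "measure_pmf.expectation p f - measure_pmf.expectation q f = (\<Sum>x\<in>?U. f x * ?d x)"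
    using U by (rule expectation_diff) auto
  also have "\<dots> \<le> (\<Sum>x\<in>?U. if 0 \<le> ?d x then ?d x else 0)"
    using f by (intro sum_mono) (auto intro: mult_left_le_one_le mult_nonneg_nonpos)
  also have "\<dots> = sum ?d ?P"
    using U by (rule sum.inter_filter[symmetric])
  also have "\<dots> = sum (pmf p) ?P - sum (pmf q) ?P"
    by (rule sum_subtractf)
  also have "\<dots> = measure_pmf.prob p ?P - measure_pmf.prob q ?P"
    using U by (simp add: measure_measure_pmf_finite)
  also have "\<dots> \<le> tv_dist p q" using tv_dist_ge[of p ?P q] by linarith
  finally show ?thesis .
qed

lemma sum_abs_diff_le_tv_dist:
  assumes "finite (set_pmf p)" "finite (set_pmf q)"
  shows "(\<Sum>x\<in>set_pmf p \<union> set_pmf q. \<bar>pmf p x - pmf q x\<bar>) \<le> 2 * tv_dist p q"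
proof -
  let ?U = "set_pmf p \<union> set_pmf q"
  \<comment> \<open>Both indicators contain the ties, where the difference vanishes.\<close>
  let ?f = "\<lambda>x. if pmf q x \<le> pmf p x then 1 else 0 :: real" and ?g = "\<lambda>x. if pmf p x \<le> pmf q x then 1 else 0 :: real"
  have U: "finite ?U" using assms by simp
  have "measure_pmf.expectation p ?f - measure_pmf.expectation q ?f \<le> tv_dist p q"
    "measure_pmf.expectation q ?g - measure_pmf.expectation p ?g \<le> tv_dist q p"
    using assms by (auto intro!: expectation_diff_le_tv_dist)
  moreover have "(\<Sum>x\<in>?U. \<bar>pmf p x - pmf q x\<bar>) =
      (\<Sum>x\<in>?U. ?f x * (pmf p x - pmf q x)) + (\<Sum>x\<in>?U. ?g x * (pmf q x - pmf p x))"
    by (simp add: sum.distrib[symmetric]) (auto intro!: sum.cong)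
  ultimately show ?thesis
    using U by (simp add: expectation_diff[of ?U] tv_dist_commute[of q p])
qed

text \<open>The data processing inequality: testing \<open>A\<close> after the common kernel
  \<open>K\<close> amounts to testing the function
  \<open>\<lambda>x. measure_pmf.prob (K x) A\<close> before it, and this function lies between 0
  and 1.\<close>

lemma tv_dist_bind_le:
  assumes p: "finite (set_pmf p)" and q: "finite (set_pmf q)"
    and K: "\<And>x. x \<in> set_pmf p \<union> set_pmf q \<Longrightarrow> finite (set_pmf (K x))"
  shows "tv_dist (bind_pmf p K) (bind_pmf q K) \<le> tv_dist p q"
proof -
  have prob: "measure_pmf.prob (bind_pmf r K) A = measure_pmf.expectation r (\<lambda>x. measure_pmf.prob (K x) A)"
    if "set_pmf r \<subseteq> set_pmf p \<union> set_pmf q" for r A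
  proof -
    have r: "finite (set_pmf r)" using that p q finite_subset by blast
    have "measure_pmf.prob (bind_pmf r K) A = measure_pmf.expectation (bind_pmf r K) (indicator A)"
      by simp
    also have "\<dots> = (\<Sum>x\<in>set_pmf r. pmf r x *\<^sub>R measure_pmf.expectation (K x) (indicator A))"
      using r that K by (intro pmf_expectation_bind) auto
    also have "\<dots> = measure_pmf.expectation r (\<lambda>x. measure_pmf.prob (K x) A)"
      using r by (subst integral_measure_pmf_real[of "set_pmf r"]) (auto simp: mult.commute)
    finally show ?thesis .
  qed
  have "measure_pmf.prob (bind_pmf p K) A - measure_pmf.prob (bind_pmf q K) A \<le> tv_dist p q"
    "measure_pmf.prob (bind_pmf q K) A - measure_pmf.prob (bind_pmf p K) A \<le> tv_dist q p" for A
    unfolding prob[OF Un_upper1] prob[OF Un_upper2]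
    using p q by (auto intro: expectation_diff_le_tv_dist)
  then show ?thesis
    unfolding tv_dist_def[of "bind_pmf p K"] by (intro cSUP_least) (auto simp: abs_le_iff tv_dist_commute[of q p])
qed

text \<open>Large values of \<open>f\<close> are charged to the second moments and the others to the
  total variation distance, with \<open>e\<close> balancing the two. It serves as a linear form of
  the Cauchy-Schwarz inequality, without square roots.\<close>

lemma expectation_diff_le_second_moment:
  fixes f :: "'x \<Rightarrow> real"
  assumes p: "finite (set_pmf p)" and q: "finite (set_pmf q)" and e: "0 < e"
  shows "\<bar>measure_pmf.expectation p f - measure_pmf.expectation q f\<bar> \<le>
    e * (measure_pmf.expectation p (\<lambda>x. (f x)\<^sup>2) + measure_pmf.expectation q (\<lambda>x. (f x)\<^sup>2)) + 2 * tv_dist p q / e"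
proof -
  let ?U = "set_pmf p \<union> set_pmf q" and ?d = "\<lambda>x. \<bar>pmf p x - pmf q x\<bar>"
  have U: "finite ?U" using p q by simp
  have am: "\<bar>t\<bar> \<le> e * t\<^sup>2 + 1 / e" for t :: real
  proof -
    \<comment> \<open>Expanding the square gives the constant \<open>1 / 4\<close>, which is relaxed
      to \<open>1\<close>.\<close>
    have "0 \<le> (e * \<bar>t\<bar> - 1 / 2)\<^sup>2" by simp
    then have "e * \<bar>t\<bar> \<le> e * (e * t\<^sup>2 + 1 / e)"
      using e by (simp add: power2_diff power_mult_distrib power2_eq_square algebra_simps)
    then show ?thesis using e by simp
  qed
  have "\<bar>measure_pmf.expectation p f - measure_pmf.expectation q f\<bar> \<le> (\<Sum>x\<in>?U. \<bar>f x\<bar> * ?d x)"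
    unfolding expectation_diff[OF U Un_upper1 Un_upper2]
    by (rule order_trans[OF sum_abs]) (simp add: abs_mult)
  also have "\<dots> \<le> (\<Sum>x\<in>?U. (e * (f x)\<^sup>2 + 1 / e) * ?d x)"
    by (intro sum_mono mult_right_mono am) simp
  also have "\<dots> = e * (\<Sum>x\<in>?U. (f x)\<^sup>2 * ?d x) + (1 / e) * (\<Sum>x\<in>?U. ?d x)"
    by (simp add: distrib_right sum.distrib sum_distrib_left mult.assoc)
  also have "(\<Sum>x\<in>?U. (f x)\<^sup>2 * ?d x) \<le> (\<Sum>x\<in>?U. (f x)\<^sup>2 * pmf p x + (f x)\<^sup>2 * pmf q x)"
  proof (intro sum_mono)
    fix x
    have "?d x \<le> pmf p x + pmf q x"
      using pmf_nonneg[of p x] pmf_nonneg[of q x] by linarith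
    then have "(f x)\<^sup>2 * ?d x \<le> (f x)\<^sup>2 * (pmf p x + pmf q x)" by (rule mult_left_mono) simp
    then show "(f x)\<^sup>2 * ?d x \<le> (f x)\<^sup>2 * pmf p x + (f x)\<^sup>2 * pmf q x" by (simp add: distrib_left)
  qed
  also have "\<dots> = measure_pmf.expectation p (\<lambda>x. (f x)\<^sup>2) + measure_pmf.expectation q (\<lambda>x. (f x)\<^sup>2)"
    using U by (subst (1 2) integral_measure_pmf_real[of ?U]) (auto simp: sum.distrib)
  also have "(\<Sum>x\<in>?U. ?d x) \<le> 2 * tv_dist p q"
    using p q by (rule sum_abs_diff_le_tv_dist)
  finally show ?thesis using e by (simp add: divide_right_mono)
qed

section \<open>Isomorphisms and the attachment step\<close>

text \<open>An isomorphism record also carries an arc map and new head and tail maps. As arcs are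
  pairs on both sides, the latter are \<open>snd\<close> and \<open>fst\<close>, and the vertex map
  determines the arc map.\<close>

lemma digraph_iso_with_proj_iff:
  assumes "pair_wf_digraph G"
  shows "digraph_iso (with_proj G) (with_proj H) \<longleftrightarrow>
    (\<exists>h. bij_betw h (pverts G) (pverts H) \<and> parcs H = map_prod h h ` parcs G)"
proof
  interpret pair_wf_digraph G by fact
  assume "digraph_iso (with_proj G) (with_proj H)"
  then obtain f where f: "digraph_isomorphism f" "with_proj H = app_iso f (with_proj G)"
    by (auto simp: digraph_iso_def)
  let ?h = "iso_verts f"
  have V: "pverts H = ?h ` pverts G" and A: "parcs H = iso_arcs f ` parcs G"
    and t: "iso_tail f = fst" and hd: "iso_head f = snd"
    using f(2) by (simp_all add: with_proj_def app_iso_def)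
  have "iso_arcs f a = map_prod ?h ?h a" if "a \<in> parcs G" for a
    using f(1) that by (cases a) (auto simp: digraph_isomorphism_def t hd prod_eq_iff)
  then have "parcs H = map_prod ?h ?h ` parcs G" unfolding A by (intro image_cong) auto
  moreover have "bij_betw ?h (pverts G) (pverts H)"
    using f(1) V by (auto simp: bij_betw_def digraph_isomorphism_def)
  ultimately show "\<exists>h. bij_betw h (pverts G) (pverts H) \<and> parcs H = map_prod h h ` parcs G" by blast
next
  interpret pair_wf_digraph G by fact
  assume "\<exists>h. bij_betw h (pverts G) (pverts H) \<and> parcs H = map_prod h h ` parcs G"
  then obtain h where h: "inj_on h (pverts G)" "pverts H = h ` pverts G" "parcs H = map_prod h h ` parcs G"
    by (auto simp: bij_betw_def)
  have "inj_on (map_prod h h) (parcs G)"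
    by (rule inj_on_subset[OF map_prod_inj_on[OF h(1) h(1)]]) (use wellformed' in auto)
  let ?f = "\<lparr> iso_verts = h, iso_arcs = map_prod h h, iso_head = snd, iso_tail = fst \<rparr>"
  have "digraph_isomorphism ?f"
    using \<open>inj_on (map_prod h h) (parcs G)\<close> h wf_digraph by (simp add: digraph_isomorphism_def)
  moreover have "with_proj H = app_iso ?f (with_proj G)"
    using h by (simp add: with_proj_def app_iso_def)
  ultimately show "digraph_iso (with_proj G) (with_proj H)"
    unfolding digraph_iso_def by blast
qed

lemma (in pair_wf_digraph) out_degree_bij_betw:
  assumes h: "bij_betw h (pverts G) (pverts H)" "parcs H = map_prod h h ` parcs G" and u: "u \<in> pverts G"
  shows "out_degree (with_proj H) (h u) = out_degree (with_proj G) u"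
proof -
  have inj: "inj_on h (pverts G)" using h by (auto simp: bij_betw_def)
  have "out_arcs (with_proj H) (h u) = map_prod h h ` out_arcs (with_proj G) u"
    using inj u wellformed' by (fastforce simp: out_arcs_def h(2) dest: inj_onD)
  moreover have "inj_on (map_prod h h) (out_arcs (with_proj G) u)"
    by (rule inj_on_subset[OF map_prod_inj_on[OF inj inj]]) (use wellformed' in \<open>auto simp: out_arcs_def\<close>)
  ultimately show ?thesis by (simp add: out_degree_def card_image)
qed

text \<open>Connectedness is transported forward. A cycle of length at least 3 in \<open>H\<close>
  would be carried back to \<open>G\<close> by an inverse isomorphism, whose injectivity keeps the
  vertices distinct.\<close>

lemma (in pair_tree) pair_tree_digraph_iso:
  assumes "digraph_iso (with_proj G) (with_proj H)"
  shows "pair_tree H"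
proof -
  obtain f where f: "digraph_isomorphism f" and H: "with_proj H = app_iso f (with_proj G)"
    using assms by (auto simp: digraph_iso_def)
  obtain h where h: "bij_betw h (pverts G) (pverts H)" "parcs H = map_prod h h ` parcs G"
    using assms digraph_iso_with_proj_iff[of G H] by (auto intro: pair_wf_digraph)
  have inj: "inj_on h (pverts G)" and V: "pverts H = h ` pverts G" using h by (auto simp: bij_betw_def)
  interpret H: pair_graph H
  proof
    show "fst e \<noteq> snd e" if "e \<in> parcs H" for e
    proof -
      obtain u v where uv: "(u, v) \<in> parcs G" "e = (h u, h v)" using \<open>e \<in> parcs H\<close> h(2) by auto
      then have "u \<noteq> v" "u \<in> pverts G" "v \<in> pverts G"
        using wellformed' pair_no_loops by force+
      then show ?thesis using inj uv by (auto dest: inj_onD)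
    qed
    have "sym (parcs H)" using arc_sym by (auto simp: h(2) intro!: symI)
    then show "symmetric (with_proj H)" by (simp add: symmetric_def)
  qed (use pair_finite_verts pair_finite_arcs wellformed' in \<open>auto simp: V h(2)\<close>)
  have con: "Digraph_Component.connected (with_proj H)"
    unfolding H using tree_connected f by (rule connectedI_app_iso)
  have acy: "\<not> (H.cycle p \<and> 3 \<le> length p)" for p
  proof
    assume "H.cycle p \<and> 3 \<le> length p"
    then obtain u where u: "H.awalk u p u" "distinct (tl (H.awalk_verts u p))" "3 \<le> length p"
      by (auto simp: H.cycle_def)
    obtain g where g: "H.digraph_isomorphism g" and G: "with_proj G = app_iso g (with_proj H)"
      using digraph_iso_swap[OF wf_digraph assms] unfolding digraph_iso_def by blast
    let ?u = "iso_verts g u" and ?p = "map (iso_arcs g) p"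
    have "awalk ?u ?p ?u" using H.awalk_app_isoI[OF u(1) g] unfolding G[symmetric] .
    moreover have "pawalk_verts ?u ?p = map (iso_verts g) (pawalk_verts u p)"
      using H.awalk_verts_app_iso_eq[OF g u(1)] unfolding G[symmetric] awalk_verts_with_proj_eq .
    moreover have "inj_on (iso_verts g) (set (tl (pawalk_verts u p)))"
    proof (rule inj_on_subset)
      show "inj_on (iso_verts g) (pverts H)" using H.digraph_isomorphism_inj_on_verts[OF g] .
      have "set (pawalk_verts u p) \<subseteq> pverts H" using u(1) by (rule H.awalkE')
      then show "set (tl (pawalk_verts u p)) \<subseteq> pverts H" by (cases "pawalk_verts u p") auto
    qed
    ultimately have "awalk ?u ?p ?u" "distinct (tl (pawalk_verts ?u ?p))"
      using u(2) unfolding awalk_verts_with_proj_eq by (metis, metis distinct_map map_tl)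
    moreover have "3 \<le> length ?p" "?p \<noteq> []" using u(3) by auto
    ultimately have "cycle ?p \<and> 3 \<le> length ?p" unfolding cycle_def by blast
    then show False using tree_acyclic by blast
  qed
  show ?thesis by unfold_locales (use con acy in auto)
qed

section \<open>Fitness, observables and moments of a tree\<close>

definition fitness :: "real \<Rightarrow> 'v pair_pre_digraph \<Rightarrow> 'v \<Rightarrow> real" where
  "fitness \<alpha> T u = real (out_degree (with_proj T) u) - 1 + \<alpha>"

definition total_fitness :: "real \<Rightarrow> nat \<Rightarrow> real" where
  "total_fitness \<alpha> n = (1 + \<alpha>) * real n - 2"

definition obs :: "real \<Rightarrow> 'p set \<Rightarrow> 'p rel \<Rightarrow> ('p \<Rightarrow> nat) \<Rightarrow> 'v pair_pre_digraph \<Rightarrow> real" where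
  "obs \<alpha> A E l T = emb_sum (pverts T) (fitness \<alpha> T) (parcs T) A E l"

definition moment :: "real \<Rightarrow> 'p set \<Rightarrow> ('p \<Rightarrow> nat) \<Rightarrow> 'v pair_pre_digraph \<Rightarrow> real" where
  "moment \<alpha> A l T = all_sum (pverts T) (fitness \<alpha> T) A l"

lemma total_fitness_pos:
  assumes "0 < \<alpha>" "2 \<le> n"
  shows "0 < total_fitness \<alpha> n"
proof -
  have "(1 + \<alpha>) * 2 \<le> (1 + \<alpha>) * real n" using assms by (intro mult_left_mono) auto
  then show ?thesis using assms by (simp add: total_fitness_def)
qed

context pair_tree begin

lemma fitness_pos:
  assumes "0 < \<alpha>" "2 \<le> graph_size G" "u \<in> pverts G"
  shows "0 < fitness \<alpha> G u"
  using degree_pos[OF assms(2,3)] assms(1) by (simp add: fitness_def)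

text \<open>A tree with \<open>n\<close> vertices has degree sum \<open>2 * n - 2\<close>, so the
  normalising constant depends on the size alone.\<close>

lemma sum_fitness: "sum (fitness \<alpha> G) (pverts G) = total_fitness \<alpha> (graph_size G)"
proof -
  have "sum (fitness \<alpha> G) (pverts G) = real (card (parcs G)) + (\<alpha> - 1) * real (graph_size G)"
    unfolding fitness_def
    by (simp add: sum.distrib sum_subtractf graph_size_def flip: sum_degree) (simp add: algebra_simps)
  also have "\<dots> = total_fitness \<alpha> (graph_size G)"
    using card_parcs by (simp add: graph_size_def total_fitness_def algebra_simps)
  finally show ?thesis .
qed

lemma pmf_attach:
  assumes "0 < \<alpha>" "2 \<le> graph_size G"
  shows "pmf (attach_pmf \<alpha> G) u
    = (if u \<in> pverts G then fitness \<alpha> G u / total_fitness \<alpha> (graph_size G) else 0)"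
  using pmf_attach_pmf[OF assms] by (simp add: fitness_def total_fitness_def)

lemma set_attach_pmf:
  assumes "0 < \<alpha>" "2 \<le> graph_size G"
  shows "set_pmf (attach_pmf \<alpha> G) = pverts G"
  using fitness_pos[OF assms] total_fitness_pos[OF assms]
  by (auto simp: set_pmf_eq pmf_attach[OF assms]) (metis less_irrefl)

lemma expectation_attach_pmf:
  fixes g :: "'a \<Rightarrow> real"
  assumes "0 < \<alpha>" "2 \<le> graph_size G"
  shows "total_fitness \<alpha> (graph_size G) * measure_pmf.expectation (attach_pmf \<alpha> G) g
    = (\<Sum>u\<in>pverts G. fitness \<alpha> G u * g u)"
proof -
  have "measure_pmf.expectation (attach_pmf \<alpha> G) g = (\<Sum>u\<in>pverts G. g u * pmf (attach_pmf \<alpha> G) u)"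
    by (rule integral_measure_pmf_real) (auto simp: pair_finite_verts set_attach_pmf[OF assms])
  then show ?thesis
    using total_fitness_pos[OF assms] by (simp add: pmf_attach[OF assms] sum_distrib_left mult.commute)
qed

lemma fitness_add_leaf:
  assumes "w \<notin> pverts G" "u \<in> pverts G" "v \<in> insert w (pverts G)"
  shows "fitness \<alpha> (add_leaf u w G) v = ((fitness \<alpha> G)(u := fitness \<alpha> G u + 1, w := \<alpha>)) v"
proof -
  let ?O = "\<lambda>v. {e \<in> parcs G. fst e = v}"
  have O: "out_arcs (with_proj (add_leaf u w G)) v =
      (if v = w then {(w, u)} else if v = u then insert (u, w) (?O u) else ?O v)"
    using assms in_arcsD1 by (auto simp: out_arcs_def add_leaf_def)
  have "(u, w) \<notin> parcs G" using assms in_arcsD2 by blast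
  then have "card (insert (u, w) (?O u)) = Suc (card (?O u))"
    using pair_finite_arcs by simp
  then show ?thesis by (simp add: fitness_def out_degree_def O) (simp add: out_arcs_def)
qed

lemma obs_add_leaf:
  assumes "w \<notin> pverts G" "u \<in> pverts G"
  shows "obs \<alpha> A E l (add_leaf u w G) = emb_sum (insert w (pverts G))
    ((fitness \<alpha> G)(u := fitness \<alpha> G u + 1, w := \<alpha>)) ({(u, w), (w, u)} \<union> parcs G) A E l"
proof -
  have "wt (insert w (pverts G)) (fitness \<alpha> (add_leaf u w G)) m
      = wt (insert w (pverts G)) ((fitness \<alpha> G)(u := fitness \<alpha> G u + 1, w := \<alpha>)) m" for m
    by (rule wt_cong) (use fitness_add_leaf[OF assms] in auto)
  then show ?thesis by (simp add: obs_def emb_sum_def add_leaf_def)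
qed

lemma moment_add_leaf:
  assumes "w \<notin> pverts G" "u \<in> pverts G"
  shows "moment \<alpha> A l (add_leaf u w G) = all_sum (insert w (pverts G))
    ((fitness \<alpha> G)(u := fitness \<alpha> G u + 1, w := \<alpha>)) A l"
proof -
  have "wt (insert w (pverts G)) (fitness \<alpha> (add_leaf u w G)) m
      = wt (insert w (pverts G)) ((fitness \<alpha> G)(u := fitness \<alpha> G u + 1, w := \<alpha>)) m" for m
    by (rule wt_cong) (use fitness_add_leaf[OF assms] in auto)
  then show ?thesis by (simp add: moment_def all_sum_def add_leaf_def)
qed

lemma obs_iso:
  assumes "digraph_iso (with_proj G) (with_proj H)"
  shows "obs \<alpha> A E l H = obs \<alpha> A E l G"
proof -
  obtain h where h: "bij_betw h (pverts G) (pverts H)" "parcs H = map_prod h h ` parcs G"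
    using assms digraph_iso_with_proj_iff[of G H] by (auto intro: pair_wf_digraph)
  show ?thesis
    unfolding obs_def
  proof (rule emb_sum_bij_betw[OF h(1) _ h(2)])
    show "parcs G \<subseteq> pverts G \<times> pverts G" using wellformed' by auto
    show "fitness \<alpha> H (h v) = fitness \<alpha> G v" if "v \<in> pverts G" for v
      using out_degree_bij_betw[OF h that] by (simp add: fitness_def)
  qed
qed

lemma obs_self_pos:
  assumes "0 < \<alpha>" "2 \<le> graph_size G"
  shows "0 < obs \<alpha> (pverts G) (parcs G) l G"
proof -
  have "restrict id (pverts G) \<in> embeddings (pverts G) (parcs G) (pverts G) (parcs G)"
    by (auto simp: embeddings_def inj_on_def)
  then show ?thesis
    unfolding obs_def emb_sum_def
    using fitness_pos[OF assms] finite_embeddings[of "pverts G" "pverts G"] pair_finite_verts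
    by (intro sum_pos) (auto intro: wt_pos)
qed

text \<open>An injective map between vertex sets of equal size is onto, and an embedding maps arcs
  injectively to arcs. Trees of equal size have equally many arcs by \<open>card_parcs\<close>, so
  an embedding would be an isomorphism.\<close>

lemma obs_eq_0:
  assumes "pair_tree H" "graph_size H = graph_size G"
    and "\<not> digraph_iso (with_proj G) (with_proj H)"
  shows "obs \<alpha> (pverts G) (parcs G) l H = 0"
proof -
  interpret H: pair_tree H by fact
  have "embeddings (pverts G) (parcs G) (pverts H) (parcs H) = {}"
  proof (rule ccontr)
    assume "\<not> ?thesis"
    then obtain f where fe: "f \<in> embeddings (pverts G) (parcs G) (pverts H) (parcs H)" by blast
    then have f: "f ` pverts G \<subseteq> pverts H" "inj_on f (pverts G)"
      by (auto simp: embeddings_def PiE_iff)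
    have e: "(f a, f b) \<in> parcs H" if "(a, b) \<in> parcs G" for a b
      using fe that wellformed' by (auto simp: embeddings_def)
    have "f ` pverts G = pverts H"
      by (rule card_subset_eq) (use f assms(2) H.pair_finite_verts in \<open>simp_all add: graph_size_def card_image\<close>)
    then have "bij_betw f (pverts G) (pverts H)"
      using f by (simp add: bij_betw_def)
    moreover have "map_prod f f ` parcs G = parcs H"
    proof (rule card_subset_eq)
      have "inj_on (map_prod f f) (parcs G)"
        by (rule inj_on_subset[OF map_prod_inj_on[OF f(2) f(2)]]) (use wellformed' in auto)
      then have "card (map_prod f f ` parcs G) = card (parcs G)" by (rule card_image)
      then show "card (map_prod f f ` parcs G) = card (parcs H)"
        using card_parcs H.card_parcs assms(2) by (simp add: graph_size_def)
    qed (use e H.pair_finite_arcs in auto)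
    ultimately show False
      using assms(3) digraph_iso_with_proj_iff[of G H] by (metis pair_wf_digraph)
  qed
  then show ?thesis by (simp add: obs_def emb_sum_def)
qed

lemma obs_power2_le:
  assumes "0 < \<alpha>" "2 \<le> graph_size G" "finite A"
  shows "(obs \<alpha> A E l G)\<^sup>2 \<le> moment \<alpha> (A <+> A) (case_sum l l) G"
  unfolding obs_def moment_def
  using assms fitness_pos by (intro emb_sum_power2_le pair_finite_verts) auto

end

section \<open>The attachment step up to isomorphism\<close>

lemma graph_size_add_leaf:
  assumes "finite (pverts T)" "w \<notin> pverts T"
  shows "graph_size (add_leaf u w T) = Suc (graph_size T)"
  using assms by (simp add: graph_size_def add_leaf_def)

lemma digraph_iso_seed_embed:
  assumes "pair_wf_digraph S"
  shows "digraph_iso (with_proj S) (with_proj (seed_embed S))"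
  unfolding digraph_iso_with_proj_iff[OF assms]
  by (intro exI[of _ Inl]) (auto simp: seed_embed_def bij_betw_def)

lemma digraph_iso_graph_size:
  assumes "pair_wf_digraph G" "digraph_iso (with_proj G) (with_proj H)"
  shows "graph_size H = graph_size G"
  using assms by (auto simp: digraph_iso_with_proj_iff graph_size_def dest: bij_betw_same_card)

lemma digraph_iso_add_leaf:
  assumes "pair_wf_digraph G" "w \<notin> pverts G" "u \<in> pverts G" "w' \<notin> pverts H"
    and h: "bij_betw h (pverts G) (pverts H)" "parcs H = map_prod h h ` parcs G"
  shows "digraph_iso (with_proj (add_leaf u w G)) (with_proj (add_leaf (h u) w' H))"
proof -
  interpret pair_wf_digraph G by fact
  have wf: "pair_wf_digraph (add_leaf u w G)"
    using assms(3) wellformed' by unfold_locales (auto simp: add_leaf_def)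
  let ?h = "h(w := w')"
  have "bij_betw ?h (pverts (add_leaf u w G)) (pverts (add_leaf (h u) w' H))"
  proof -
    have "?h ` pverts G = pverts H" "inj_on ?h (pverts G)"
      using h(1) assms(2) by (auto simp: bij_betw_def inj_on_def)
    then show ?thesis using assms(2,4) by (auto simp: add_leaf_def bij_betw_def)
  qed
  moreover have "map_prod ?h ?h ` parcs G = map_prod h h ` parcs G"
    using assms(2) wellformed' by (intro image_cong) auto
  then have "parcs (add_leaf (h u) w' H) = map_prod ?h ?h ` parcs (add_leaf u w G)"
    using assms(2,3) h(2) by (auto simp: add_leaf_def)
  ultimately show ?thesis unfolding digraph_iso_with_proj_iff[OF wf] by blast
qed

text \<open>The isomorphism \<open>h\<close> preserves degrees, hence carries one attachment law to
  the other. It extends over the new leaves, which are fresh on both sides, so corresponding choices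
  give the same class.\<close>

lemma map_iso_class_pa_step:
  fixes T :: "('a + nat) pair_pre_digraph" and T' :: "('b + nat) pair_pre_digraph"
  assumes \<alpha>: "0 < \<alpha>" and T: "pair_tree T" "2 \<le> graph_size T" "Inr (graph_size T) \<notin> pverts T"
    and T': "Inr (graph_size T') \<notin> pverts T'"
    and iso: "digraph_iso (with_proj T) (with_proj T')"
  shows "map_pmf iso_class (pa_step \<alpha> T) = map_pmf iso_class (pa_step \<alpha> T')"
proof -
  interpret pair_tree T by fact
  interpret T': pair_tree T' using iso by (rule pair_tree_digraph_iso)
  obtain h where h: "bij_betw h (pverts T) (pverts T')" "parcs T' = map_prod h h ` parcs T"
    using iso digraph_iso_with_proj_iff[of T T'] by (auto intro: pair_wf_digraph)
  have inj: "inj_on h (pverts T)" and im: "h ` pverts T = pverts T'" using h by (auto simp: bij_betw_def)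
  have n: "graph_size T' = graph_size T" using iso digraph_iso_graph_size[of T T'] by (metis pair_wf_digraph)
  have deg: "pmf (attach_pmf \<alpha> T') (h u) = pmf (attach_pmf \<alpha> T) u" if u: "u \<in> pverts T" for u
    using out_degree_bij_betw[OF h u] u im T(2) \<alpha> n by (auto simp: pmf_attach T'.pmf_attach fitness_def)
  have attach: "attach_pmf \<alpha> T' = map_pmf h (attach_pmf \<alpha> T)"
  proof (rule pmf_eqI)
    fix y
    show "pmf (attach_pmf \<alpha> T') y = pmf (map_pmf h (attach_pmf \<alpha> T)) y"
    proof (cases "y \<in> pverts T'")
      case True
      then obtain u where "u \<in> pverts T" "y = h u" using im by blast
      then show ?thesis
        using inj deg set_attach_pmf[OF \<alpha> T(2)] by (simp add: pmf_map_inj)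
    next
      case False
      then show ?thesis
        using im set_attach_pmf[OF \<alpha> T(2)] T'.set_attach_pmf[OF \<alpha>] T(2) n
        by (simp add: pmf_eq_0_set_pmf pmf_map_outside)
    qed
  qed
  show ?thesis
    unfolding pa_step_def attach pmf.map_comp
  proof (intro map_pmf_cong refl, simp)
    fix u assume "u \<in> set_pmf (attach_pmf \<alpha> T)"
    then have u: "u \<in> pverts T" using set_attach_pmf[OF \<alpha> T(2)] by simp
    have "pair_tree (add_leaf u (Inr (graph_size T)) T)"
      "pair_tree (add_leaf (h u) (Inr (graph_size T')) T')"
      using T T' u im T'.pair_tree_axioms by (auto intro!: pair_tree_add_leaf)
    then show "iso_class (add_leaf u (Inr (graph_size T)) T)
      = iso_class (add_leaf (h u) (Inr (graph_size T')) T')"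
      using digraph_iso_add_leaf[OF _ T(3) u T' h] by (simp add: iso_class_eq_iff pair_wf_digraph)
  qed
qed

section \<open>Expectations along the process\<close>

lemma expectation_cong:
  fixes f :: "'x \<Rightarrow> real"
  assumes "\<And>x. x \<in> set_pmf p \<Longrightarrow> f x = g x"
  shows "measure_pmf.expectation p f = measure_pmf.expectation p g"
  by (rule integral_cong_AE) (use assms in \<open>simp_all add: AE_measure_pmf_iff\<close>)

lemma expectation_mono:
  fixes f :: "'x \<Rightarrow> real"
  assumes "finite (set_pmf p)" "\<And>x. x \<in> set_pmf p \<Longrightarrow> f x \<le> g x"
  shows "measure_pmf.expectation p f \<le> measure_pmf.expectation p g"
  by (rule integral_mono_AE) (use assms in \<open>simp_all add: AE_measure_pmf_iff integrable_measure_pmf_finite\<close>)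

text \<open>Turns a function of trees into a function of classes. Invariance makes
  \<open>obs\<close> take the same value on all members of the class of a tree.\<close>

definition representative :: "nat pair_pre_digraph set \<Rightarrow> nat pair_pre_digraph" where
  "representative c = (SOME H. H \<in> c)"

lemma digraph_iso_representative:
  assumes "pair_tree T"
  shows "digraph_iso (with_proj T) (with_proj (representative (iso_class T)))"
proof -
  interpret pair_tree T by fact
  obtain f :: "_ \<Rightarrow> nat" where f: "inj_on f (pverts T)"
    using finite_imp_inj_to_nat_seg[OF pair_finite_verts] by metis
  let ?H = "\<lparr> pverts = f ` pverts T, parcs = map_prod f f ` parcs T \<rparr>"
  have "digraph_iso (with_proj T) (with_proj ?H)"
    unfolding digraph_iso_with_proj_iff[OF pair_wf_digraph]
    using f by (intro exI[of _ f]) (simp add: bij_betw_def)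
  then have "?H \<in> iso_class T" by (simp add: iso_class_def)
  then have "representative (iso_class T) \<in> iso_class T"
    unfolding representative_def by (rule someI)
  then show ?thesis by (simp add: iso_class_def)
qed

definition mean_obs ::
  "real \<Rightarrow> 'a pair_pre_digraph \<Rightarrow> 'p set \<Rightarrow> 'p rel \<Rightarrow> ('p \<Rightarrow> nat) \<Rightarrow> nat \<Rightarrow> real" where
  "mean_obs \<alpha> S A E l n = measure_pmf.expectation (pa_tree \<alpha> S n) (obs \<alpha> A E l)"

definition mean_moment ::
  "real \<Rightarrow> 'a pair_pre_digraph \<Rightarrow> 'p set \<Rightarrow> ('p \<Rightarrow> nat) \<Rightarrow> nat \<Rightarrow> real" where
  "mean_moment \<alpha> S A l n = measure_pmf.expectation (pa_tree \<alpha> S n) (moment \<alpha> A l)"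

text \<open>Passing through \<^const>\<open>seed_embed\<close> provides the fresh vertex that \<^const>\<open>pa_step\<close> adds.\<close>

definition iso_step :: "real \<Rightarrow> nat pair_pre_digraph set \<Rightarrow> nat pair_pre_digraph set pmf" where
  "iso_step \<alpha> c = map_pmf iso_class (pa_step \<alpha> (seed_embed (representative c)))"

section \<open>Moments of the process grown from a fixed seed\<close>

context
  fixes \<alpha> :: real and S :: "'a pair_pre_digraph"
  assumes \<alpha>: "0 < \<alpha>" and S: "pair_tree S" "2 \<le> graph_size S"
begin

text \<open>Freshness is carried for all later labels, since the induction step uses it at the
  current label and must pass it on for the following ones.\<close>

lemma pa_grow_support:
  assumes "T \<in> set_pmf (pa_grow \<alpha> S m)"
  shows "pair_tree T \<and> graph_size T = graph_size S + m \<and> (\<forall>j\<ge>graph_size S + m. Inr j \<notin> pverts T)"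
  using assms
proof (induction m arbitrary: T)
  case 0
  interpret pair_tree S by fact
  have iso: "digraph_iso (with_proj S) (with_proj (seed_embed S))"
    using pair_wf_digraph by (rule digraph_iso_seed_embed)
  have "pair_tree (seed_embed S)" "graph_size (seed_embed S) = graph_size S"
    using pair_tree_digraph_iso[OF iso] digraph_iso_graph_size[OF pair_wf_digraph iso] by auto
  then show ?case using 0 by (auto simp: seed_embed_def)
next
  case (Suc m)
  then obtain T' where T': "T' \<in> set_pmf (pa_grow \<alpha> S m)" "T \<in> set_pmf (pa_step \<alpha> T')"
    by auto
  let ?n = "graph_size S + m"
  have IH: "pair_tree T'" "graph_size T' = ?n" "\<And>j. ?n \<le> j \<Longrightarrow> Inr j \<notin> pverts T'"
    using Suc.IH[OF T'(1)] by auto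
  interpret pair_tree T' by fact
  obtain u where u: "u \<in> pverts T'" "T = add_leaf u (Inr ?n) T'"
    using T'(2) set_attach_pmf[OF \<alpha>] IH S by (auto simp: pa_step_def)
  then show ?case
    using IH pair_finite_verts by (auto simp: pair_tree_add_leaf graph_size_add_leaf) (auto simp: add_leaf_def)
qed

lemma finite_set_pa_step:
  assumes "pair_tree T" "2 \<le> graph_size T"
  shows "finite (set_pmf (pa_step \<alpha> T))"
  using assms pair_tree.set_attach_pmf[OF assms(1) \<alpha> assms(2)]
  by (simp add: pa_step_def pair_fin_digraph.pair_finite_verts pair_tree_def pair_graph_def pair_digraph_def)

lemma finite_set_pa_grow: "finite (set_pmf (pa_grow \<alpha> S m))"
proof (induction m)
  case (Suc m)
  then show ?case using pa_grow_support S by (auto simp: trans_le_add1 intro!: finite_set_pa_step)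
qed simp

lemma pa_tree_support:
  assumes "T \<in> set_pmf (pa_tree \<alpha> S n)" "graph_size S \<le> n"
  shows "pair_tree T" "graph_size T = n" "Inr n \<notin> pverts T"
  using pa_grow_support[of T "n - graph_size S"] assms by (auto simp: pa_tree_def)

lemma finite_set_pa_tree: "finite (set_pmf (pa_tree \<alpha> S n))"
  unfolding pa_tree_def by (rule finite_set_pa_grow)

lemma pa_tree_Suc:
  "graph_size S \<le> n \<Longrightarrow> pa_tree \<alpha> S (Suc n) = bind_pmf (pa_tree \<alpha> S n) (pa_step \<alpha>)"
  by (simp add: pa_tree_def Suc_diff_le)

text \<open>Conditioning on the tree of size \<open>n\<close>. Multiplied by the total fitness, the
  average over the attachment vertex becomes the fitness-weighted sum evaluated by
  \<open>emb_sum_step\<close> and \<open>all_sum_step\<close>.\<close>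

lemma expectation_pa_tree_Suc:
  fixes g :: "('a + nat) pair_pre_digraph \<Rightarrow> real"
  assumes n: "graph_size S \<le> n"
    and G: "\<And>T :: ('a + nat) pair_pre_digraph.
      pair_tree T \<Longrightarrow> graph_size T = n \<Longrightarrow> Inr n \<notin> pverts T \<Longrightarrow>
      (\<Sum>u\<in>pverts T. fitness \<alpha> T u * g (add_leaf u (Inr n) T)) = G T"
  shows "total_fitness \<alpha> n * measure_pmf.expectation (pa_tree \<alpha> S (Suc n)) g
    = measure_pmf.expectation (pa_tree \<alpha> S n) G"
proof -
  let ?p = "pa_tree \<alpha> S n"
  have "measure_pmf.expectation (pa_tree \<alpha> S (Suc n)) g
    = (\<Sum>T\<in>set_pmf ?p. pmf ?p T *\<^sub>R measure_pmf.expectation (pa_step \<alpha> T) g)"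
    unfolding pa_tree_Suc[OF n]
    by (rule pmf_expectation_bind)
       (use pa_tree_support[OF _ n] S n finite_set_pa_tree in \<open>auto intro!: finite_set_pa_step\<close>)
  also have "total_fitness \<alpha> n * \<dots> = (\<Sum>T\<in>set_pmf ?p. G T * pmf ?p T)"
    unfolding sum_distrib_left
  proof (rule sum.cong[OF refl])
    fix T assume T: "T \<in> set_pmf ?p"
    note sup = pa_tree_support[OF T n]
    have "total_fitness \<alpha> n * measure_pmf.expectation (pa_step \<alpha> T) g = G T"
      using pair_tree.expectation_attach_pmf[OF sup(1) \<alpha>, of "\<lambda>u. g (add_leaf u (Inr n) T)"]
        G[OF sup] sup S n by (simp add: pa_step_def)
    then show "total_fitness \<alpha> n * (pmf ?p T *\<^sub>R measure_pmf.expectation (pa_step \<alpha> T) g) = G T * pmf ?p T"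
      by (simp add: mult_ac)
  qed
  also have "\<dots> = measure_pmf.expectation ?p G"
    by (rule integral_measure_pmf_real[symmetric]) (auto simp: finite_set_pa_tree)
  finally show ?thesis .
qed

lemma mean_obs_Suc:
  assumes A: "finite A" and E: "irrefl E" and n: "graph_size S \<le> n"
  shows "total_fitness \<alpha> n * mean_obs \<alpha> S A E l (Suc n)
    = (total_fitness \<alpha> n + real (sum l A)) * mean_obs \<alpha> S A E l n
      + (\<Sum>a\<in>A. pochhammer \<alpha> (l a) *
          (if nbrs E A a = {} then (total_fitness \<alpha> n + real (sum l (A - {a}))) * mean_obs \<alpha> S (A - {a}) E l n
           else if is_singleton (nbrs E A a)
           then let p = the_elem (nbrs E A a) in mean_obs \<alpha> S (A - {a}) E (l(p := Suc (l p))) n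
           else 0))"
    (is "_ = _ + (\<Sum>a\<in>A. _ * ?m a)")
proof -
  let ?p = "pa_tree \<alpha> S n" and ?Z = "total_fitness \<alpha> n"
  let ?q = "\<lambda>a T. if nbrs E A a = {} then (?Z + real (sum l (A - {a}))) * obs \<alpha> (A - {a}) E l T
           else if is_singleton (nbrs E A a)
           then obs \<alpha> (A - {a}) E (l(the_elem (nbrs E A a) := Suc (l (the_elem (nbrs E A a))))) T
           else 0"
  have int: "integrable (measure_pmf ?p) f" for f :: "_ \<Rightarrow> real"
    by (rule integrable_measure_pmf_finite[OF finite_set_pa_tree])
  have m: "measure_pmf.expectation ?p (?q a) = ?m a" for a
    by (simp add: mean_obs_def Let_def)
  have "?Z * mean_obs \<alpha> S A E l (Suc n) = measure_pmf.expectation ?p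
      (\<lambda>T. (?Z + real (sum l A)) * obs \<alpha> A E l T + (\<Sum>a\<in>A. pochhammer \<alpha> (l a) * ?q a T))"
    unfolding mean_obs_def
  proof (rule expectation_pa_tree_Suc[OF n])
    fix T :: "('a + nat) pair_pre_digraph"
    assume T: "pair_tree T" "graph_size T = n" "Inr n \<notin> pverts T"
    interpret pair_tree T by fact
    have q: "pruned_sum (pverts T) (fitness \<alpha> T) (parcs T) A E l a = ?q a T" for a
      by (simp add: pruned_sum_def obs_def sum_fitness T Let_def)
    have "(\<Sum>u\<in>pverts T. fitness \<alpha> T u * obs \<alpha> A E l (add_leaf u (Inr n) T))
      = (\<Sum>u\<in>pverts T. fitness \<alpha> T u * emb_sum (insert (Inr n) (pverts T))
          ((fitness \<alpha> T)(u := fitness \<alpha> T u + 1, Inr n := \<alpha>))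
          ({(u, Inr n), (Inr n, u)} \<union> parcs T) A E l)"
      by (intro sum.cong refl) (simp add: obs_add_leaf[OF T(3)])
    also have "\<dots> = (?Z + real (sum l A)) * obs \<alpha> A E l T
        + (\<Sum>a\<in>A. pochhammer \<alpha> (l a) * pruned_sum (pverts T) (fitness \<alpha> T) (parcs T) A E l a)"
      unfolding obs_def
      by (subst emb_sum_step) (use A E T wellformed' pair_finite_verts sum_fitness in auto)
    also have "\<dots> = (?Z + real (sum l A)) * obs \<alpha> A E l T + (\<Sum>a\<in>A. pochhammer \<alpha> (l a) * ?q a T)"
      by (simp only: q)
    finally show "(\<Sum>u\<in>pverts T. fitness \<alpha> T u * obs \<alpha> A E l (add_leaf u (Inr n) T))
      = (?Z + real (sum l A)) * obs \<alpha> A E l T + (\<Sum>a\<in>A. pochhammer \<alpha> (l a) * ?q a T)" .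
  qed
  also have "\<dots> = (?Z + real (sum l A)) * mean_obs \<alpha> S A E l n
      + (\<Sum>a\<in>A. pochhammer \<alpha> (l a) * measure_pmf.expectation ?p (?q a))"
    unfolding mean_obs_def by (subst Bochner_Integration.integral_add[OF int int], subst Bochner_Integration.integral_sum[OF int]) simp
  finally show ?thesis unfolding m .
qed

lemma mean_moment_Suc:
  assumes A: "finite A" and n: "graph_size S \<le> n"
  shows "total_fitness \<alpha> n * mean_moment \<alpha> S A l (Suc n) = (\<Sum>J\<in>Pow A. pochhammer \<alpha> (sum l J) *
      ((total_fitness \<alpha> n + real (sum l (A - J))) * mean_moment \<alpha> S (A - J) l n))"
proof -
  let ?p = "pa_tree \<alpha> S n" and ?Z = "total_fitness \<alpha> n"
  have int: "integrable (measure_pmf ?p) f" for f :: "_ \<Rightarrow> real"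
    by (rule integrable_measure_pmf_finite[OF finite_set_pa_tree])
  have "?Z * mean_moment \<alpha> S A l (Suc n) = measure_pmf.expectation ?p
      (\<lambda>T. \<Sum>J\<in>Pow A. pochhammer \<alpha> (sum l J) * ((?Z + real (sum l (A - J))) * moment \<alpha> (A - J) l T))"
    unfolding mean_moment_def
  proof (rule expectation_pa_tree_Suc[OF n])
    fix T :: "('a + nat) pair_pre_digraph"
    assume T: "pair_tree T" "graph_size T = n" "Inr n \<notin> pverts T"
    interpret pair_tree T by fact
    have "(\<Sum>u\<in>pverts T. fitness \<alpha> T u * moment \<alpha> A l (add_leaf u (Inr n) T))
      = (\<Sum>u\<in>pverts T. fitness \<alpha> T u * all_sum (insert (Inr n) (pverts T))
          ((fitness \<alpha> T)(u := fitness \<alpha> T u + 1, Inr n := \<alpha>)) A l)"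
      by (intro sum.cong refl) (simp add: moment_add_leaf[OF T(3)])
    also have "\<dots> = (\<Sum>J\<in>Pow A. pochhammer \<alpha> (sum l J) *
        ((?Z + real (sum l (A - J))) * moment \<alpha> (A - J) l T))"
      by (subst all_sum_step) (use A T pair_finite_verts sum_fitness[of \<alpha>] in \<open>auto simp: moment_def\<close>)
    finally show "(\<Sum>u\<in>pverts T. fitness \<alpha> T u * moment \<alpha> A l (add_leaf u (Inr n) T)) = \<dots>" .
  qed
  also have "\<dots> = (\<Sum>J\<in>Pow A. pochhammer \<alpha> (sum l J) *
      ((?Z + real (sum l (A - J))) * mean_moment \<alpha> S (A - J) l n))"
    unfolding mean_moment_def by (subst Bochner_Integration.integral_sum[OF int]) simp
  finally show ?thesis .
qed

text \<open>Induction on \<open>A\<close> through \<open>growth_domination\<close>. The set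
  \<open>J = {}\<close> gives the leading factor; for nonempty \<open>J\<close> the exponents over
  \<open>J\<close> sum to more than \<open>1 + \<alpha>\<close>, which is the gap required between
  the growth of the smaller moment and that of \<open>A\<close>.\<close>

lemma mean_moment_le_growth:
  assumes k: "graph_size S \<le> k" and "finite A" "\<And>a. a \<in> A \<Longrightarrow> 1 + \<alpha> < real (l a)"
  shows "\<exists>C. \<forall>n\<ge>k. mean_moment \<alpha> S A l n \<le> C * growth (total_fitness \<alpha>) k (real (sum l A)) n"
  using assms(2,3)
proof (induction A rule: finite_psubset_induct)
  case (psubset A)
  let ?I = "Pow A - {{}}" and ?Z = "total_fitness \<alpha>"
  have sum: "sum l A = sum l (A - J) + sum l J" if "J \<subseteq> A" for J
    using sum.subset_diff[OF that psubset.hyps] .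
  show ?case
  proof (rule growth_domination[where I = ?I and c = "1 + \<alpha>" and b = "\<lambda>J. real (sum l (A - J))"
        and p = "\<lambda>J. pochhammer \<alpha> (sum l J)" and g = "\<lambda>J. mean_moment \<alpha> S (A - J) l"])
    show "0 < ?Z i" if "k \<le> i" for i
      using that k S \<alpha> by (intro total_fitness_pos) auto
    show "?Z (Suc i) = ?Z i + (1 + \<alpha>)" for i
      by (simp add: total_fitness_def algebra_simps)
    show "0 \<le> real (sum l (A - J)) \<and> 1 + \<alpha> < real (sum l A) - real (sum l (A - J))" if J: "J \<in> ?I" for J
    proof -
      obtain j where j: "j \<in> J" "j \<in> A" using J by blast
      have "finite J" using J psubset.hyps finite_subset by blast
      then have "l j \<le> sum l J" using j by (simp add: member_le_sum)
      then have "1 + \<alpha> < real (sum l J)" using psubset.prems[OF j(2)] by linarith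
      moreover have "real (sum l A) = real (sum l (A - J)) + real (sum l J)"
        using sum[of J] J by (metis DiffD1 PowD of_nat_add)
      ultimately show ?thesis by linarith
    qed
    show "\<exists>C. \<forall>i\<ge>k. mean_moment \<alpha> S (A - J) l i \<le> C * growth ?Z k (real (sum l (A - J))) i" if "J \<in> ?I" for J
      by (rule psubset.IH) (use that psubset.prems in auto)
    show "?Z i * mean_moment \<alpha> S A l (Suc i) \<le> (?Z i + real (sum l A)) * mean_moment \<alpha> S A l i
        + (\<Sum>J\<in>?I. pochhammer \<alpha> (sum l J) * ((?Z i + real (sum l (A - J))) * mean_moment \<alpha> S (A - J) l i))"
      if "k \<le> i" for i
      using mean_moment_Suc[OF psubset.hyps, of i l] that k psubset.hyps
      by (simp add: sum.remove[of "Pow A" "{}"])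
    show "0 \<le> real (sum l A)" by (rule of_nat_0_le_iff)
  qed (use \<alpha> psubset.hyps in \<open>auto intro: less_imp_le pochhammer_pos\<close>)
qed

text \<open>On \<open>A <+> A\<close> the total exponent is doubled, and
  \<open>growth_add_le\<close> bounds the resulting growth factor by a square.\<close>

lemma mean_obs_power2_le_growth:
  assumes k: "graph_size S \<le> k" and A: "finite A" "\<And>a. a \<in> A \<Longrightarrow> 1 + \<alpha> < real (l a)"
  shows "\<exists>C. \<forall>n\<ge>k. measure_pmf.expectation (pa_tree \<alpha> S n) (\<lambda>T. (obs \<alpha> A E l T)\<^sup>2)
    \<le> C * (growth (total_fitness \<alpha>) k (real (sum l A)) n)\<^sup>2"
proof -
  let ?Z = "total_fitness \<alpha>"
  have Z: "0 < ?Z i" if "k \<le> i" for i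
    using that k S \<alpha> by (intro total_fitness_pos) auto
  obtain C where C: "\<And>n. k \<le> n \<Longrightarrow> mean_moment \<alpha> S (A <+> A) (case_sum l l) n
      \<le> C * growth ?Z k (real (sum (case_sum l l) (A <+> A))) n"
  proof -
    have "\<exists>C. \<forall>n\<ge>k. mean_moment \<alpha> S (A <+> A) (case_sum l l) n
        \<le> C * growth ?Z k (real (sum (case_sum l l) (A <+> A))) n"
      using A by (intro mean_moment_le_growth k) auto
    then show ?thesis using that by blast
  qed
  have s: "real (sum (case_sum l l) (A <+> A)) = real (sum l A) + real (sum l A)"
    using A by (simp add: sum.Plus)
  have "measure_pmf.expectation (pa_tree \<alpha> S n) (\<lambda>T. (obs \<alpha> A E l T)\<^sup>2)
      \<le> \<bar>C\<bar> * (growth ?Z k (real (sum l A)) n)\<^sup>2" if n: "k \<le> n" for n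
  proof -
    have "measure_pmf.expectation (pa_tree \<alpha> S n) (\<lambda>T. (obs \<alpha> A E l T)\<^sup>2)
        \<le> mean_moment \<alpha> S (A <+> A) (case_sum l l) n"
      unfolding mean_moment_def
    proof (rule expectation_mono[OF finite_set_pa_tree])
      fix T assume T: "T \<in> set_pmf (pa_tree \<alpha> S n)"
      have "pair_tree T" "graph_size T = n" using pa_tree_support[OF T] k n by auto
      then show "(obs \<alpha> A E l T)\<^sup>2 \<le> moment \<alpha> (A <+> A) (case_sum l l) T"
        using \<alpha> A S k n by (intro pair_tree.obs_power2_le) auto
    qed
    also have "\<dots> \<le> C * growth ?Z k (real (sum l A) + real (sum l A)) n"
      using C[OF n] unfolding s .
    also have "\<dots> \<le> \<bar>C\<bar> * (growth ?Z k (real (sum l A)) n)\<^sup>2"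
    proof -
      have s: "0 \<le> real (sum l A)" by (rule of_nat_0_le_iff)
      have "0 < growth ?Z k (real (sum l A) + real (sum l A)) n"
        by (intro growth_pos Z add_nonneg_nonneg s)
      then show ?thesis
        unfolding power2_eq_square
        by (intro mult_mono growth_add_le Z s) simp_all
    qed
    finally show ?thesis .
  qed
  then show ?thesis by blast
qed

section \<open>The Markov chain of isomorphism classes\<close>

lemma finite_set_unlabelled: "finite (set_pmf (unlabelled_pa_tree \<alpha> S n))"
  by (simp add: unlabelled_pa_tree_def finite_set_pa_tree)

text \<open>The representative, embedded as a seed, is isomorphic to \<open>T\<close> and has only
  vertices tagged \<open>Inl\<close>. Thus the new label is fresh for it and
  \<open>map_iso_class_pa_step\<close> applies.\<close>

lemma iso_step_iso_class:
  fixes T :: "('b + nat) pair_pre_digraph"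
  assumes "pair_tree T" "2 \<le> graph_size T" "Inr (graph_size T) \<notin> pverts T"
  shows "iso_step \<alpha> (iso_class T) = map_pmf iso_class (pa_step \<alpha> T)"
proof -
  interpret pair_tree T by fact
  let ?H = "representative (iso_class T)"
  have iso: "digraph_iso (with_proj T) (with_proj ?H)"
    using assms(1) by (rule digraph_iso_representative)
  interpret H: pair_tree ?H using iso by (rule pair_tree_digraph_iso)
  have iso': "digraph_iso (with_proj T) (with_proj (seed_embed ?H))"
    using iso digraph_iso_seed_embed[OF H.pair_wf_digraph] by (rule digraph_iso_trans)
  have "Inr (graph_size (seed_embed ?H)) \<notin> pverts (seed_embed ?H)"
    by (auto simp: seed_embed_def)
  then show ?thesis
    unfolding iso_step_def by (rule map_iso_class_pa_step[OF \<alpha> assms _ iso', symmetric])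
qed

lemma unlabelled_pa_tree_Suc:
  assumes "graph_size S \<le> n"
  shows "unlabelled_pa_tree \<alpha> S (Suc n) = bind_pmf (unlabelled_pa_tree \<alpha> S n) (iso_step \<alpha>)"
proof -
  have "unlabelled_pa_tree \<alpha> S (Suc n)
    = bind_pmf (pa_tree \<alpha> S n) (\<lambda>T. map_pmf iso_class (pa_step \<alpha> T))"
    using assms by (simp add: unlabelled_pa_tree_def pa_tree_Suc map_bind_pmf)
  also have "\<dots> = bind_pmf (pa_tree \<alpha> S n) (\<lambda>T. iso_step \<alpha> (iso_class T))"
    by (intro bind_pmf_cong refl)
       (use assms S pa_tree_support[OF _ assms] in \<open>simp add: iso_step_iso_class\<close>)
  finally show ?thesis by (simp add: unlabelled_pa_tree_def bind_map_pmf)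
qed

lemma finite_set_iso_step:
  assumes "c \<in> set_pmf (unlabelled_pa_tree \<alpha> S n)" "graph_size S \<le> n"
  shows "finite (set_pmf (iso_step \<alpha> c))"
proof -
  obtain T where T: "T \<in> set_pmf (pa_tree \<alpha> S n)" "c = iso_class T"
    using assms by (auto simp: unlabelled_pa_tree_def)
  then show ?thesis
    using pa_tree_support[OF T(1) assms(2)] S assms(2) by (simp add: iso_step_iso_class finite_set_pa_step)
qed

text \<open>The function \<open>f\<close> lets one transfer serve both the normalised observable and
  its square.\<close>

lemma expectation_unlabelled_obs:
  assumes "graph_size S \<le> n"
  shows "measure_pmf.expectation (unlabelled_pa_tree \<alpha> S n) (\<lambda>c. f (obs \<alpha> A E l (representative c)))
    = measure_pmf.expectation (pa_tree \<alpha> S n) (\<lambda>T. f (obs \<alpha> A E l T) :: real)"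
proof -
  have "obs \<alpha> A E l (representative (iso_class T)) = obs \<alpha> A E l T"
    if T: "T \<in> set_pmf (pa_tree \<alpha> S n)" for T
    using pa_tree_support(1)[OF T assms] by (intro pair_tree.obs_iso digraph_iso_representative)
  then show ?thesis
    unfolding unlabelled_pa_tree_def integral_map_pmf by (intro expectation_cong) simp
qed

lemma mean_obs_pos:
  assumes n: "graph_size S \<le> n" and T: "T \<in> set_pmf (pa_tree \<alpha> S n)" and pos: "0 < obs \<alpha> A E l T"
  shows "0 < mean_obs \<alpha> S A E l n"
proof -
  let ?p = "pa_tree \<alpha> S n"
  have "mean_obs \<alpha> S A E l n = (\<Sum>T\<in>set_pmf ?p. obs \<alpha> A E l T * pmf ?p T)"
    unfolding mean_obs_def by (rule integral_measure_pmf_real) (auto simp: finite_set_pa_tree)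
  also have "\<dots> > 0"
  proof (rule sum_pos2[OF finite_set_pa_tree T])
    show "0 < obs \<alpha> A E l T * pmf ?p T" using pos T by (simp add: pmf_positive)
    fix U assume U: "U \<in> set_pmf ?p"
    have "pair_tree U" "2 \<le> graph_size U" using pa_tree_support[OF U n] S n by auto
    then have "0 \<le> obs \<alpha> A E l U"
      unfolding obs_def by (auto intro!: emb_sum_nonneg pair_tree.fitness_pos \<alpha>)
    then show "0 \<le> obs \<alpha> A E l U * pmf ?p U" by simp
  qed
  finally show ?thesis .
qed

end

section \<open>Separation of the seeds\<close>

text \<open>Both unlabelled processes move by the same kernel \<open>iso_step \<alpha>\<close>, so
  \<open>tv_dist_bind_le\<close> applies.\<close>

lemma tv_dist_Suc_le:
  assumes "0 < \<alpha>" "pair_tree S" "2 \<le> graph_size S" "pair_tree S'" "2 \<le> graph_size S'"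
    and n: "graph_size S \<le> n" "graph_size S' \<le> n"
  shows "tv_dist (unlabelled_pa_tree \<alpha> S (Suc n)) (unlabelled_pa_tree \<alpha> S' (Suc n))
    \<le> tv_dist (unlabelled_pa_tree \<alpha> S n) (unlabelled_pa_tree \<alpha> S' n)"
  unfolding unlabelled_pa_tree_Suc[OF assms(1-3) n(1)] unlabelled_pa_tree_Suc[OF assms(1,4,5) n(2)]
proof (rule tv_dist_bind_le)
  show "finite (set_pmf (unlabelled_pa_tree \<alpha> S n))" "finite (set_pmf (unlabelled_pa_tree \<alpha> S' n))"
    using assms by (simp_all add: finite_set_unlabelled)
  fix c assume "c \<in> set_pmf (unlabelled_pa_tree \<alpha> S n) \<union> set_pmf (unlabelled_pa_tree \<alpha> S' n)"
  then show "finite (set_pmf (iso_step \<alpha> c))"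
    using finite_set_iso_step[OF assms(1-3) _ n(1), of c] finite_set_iso_step[OF assms(1,4,5) _ n(2), of c]
    by (elim UnE)
qed

section \<open>An observable that separates the seeds\<close>

lemma digraph_iso_sum_fitness:
  assumes "pair_wf_digraph G" "digraph_iso (with_proj G) (with_proj H)"
  shows "(\<Sum>v\<in>pverts H. f (fitness \<alpha> H v)) = (\<Sum>v\<in>pverts G. f (fitness \<alpha> G v))"
proof -
  obtain h where h: "bij_betw h (pverts G) (pverts H)" "parcs H = map_prod h h ` parcs G"
    using assms(2) unfolding digraph_iso_with_proj_iff[OF assms(1)] by blast
  have "(\<Sum>v\<in>pverts H. f (fitness \<alpha> H v)) = (\<Sum>v\<in>pverts G. f (fitness \<alpha> H (h v)))"
    by (rule sum.reindex_bij_betw[OF h(1), symmetric])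
  also have "\<dots> = (\<Sum>v\<in>pverts G. f (fitness \<alpha> G v))"
    by (rule sum.cong) (use pair_wf_digraph.out_degree_bij_betw[OF assms(1) h] in \<open>auto simp: fitness_def\<close>)
  finally show ?thesis .
qed

context pair_tree begin

text \<open>If all degrees were \<open>d\<close>, counting arcs on \<open>n\<close> vertices would
  give \<open>n * d + 2 = 2 * n\<close>, which forces \<open>n = 1\<close> or
  \<open>n = 2\<close>.\<close>

lemma exists_fitness_neq:
  assumes "3 \<le> graph_size G"
  shows "\<exists>u\<in>pverts G. \<exists>v\<in>pverts G. fitness \<alpha> G u \<noteq> fitness \<alpha> G v"
proof (rule ccontr)
  assume neg: "\<not> ?thesis"
  have eq: "out_degree (with_proj G) u = out_degree (with_proj G) v"
    if "u \<in> pverts G" "v \<in> pverts G" for u v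
  proof -
    have "fitness \<alpha> G u = fitness \<alpha> G v" using neg that by blast
    then show ?thesis by (simp add: fitness_def)
  qed
  obtain v where v: "v \<in> pverts G" using verts_nonempty by blast
  define d where "d = out_degree (with_proj G) v"
  have "(\<Sum>u\<in>pverts G. out_degree (with_proj G) u) = (\<Sum>u\<in>pverts G. d)"
    unfolding d_def by (intro sum.cong refl eq v)
  then have "card (parcs G) = card (pverts G) * d"
    by (simp add: sum_degree)
  then have *: "card (pverts G) * d + 2 = 2 * card (pverts G)"
    using card_parcs by simp
  consider "d = 0" | "d = 1" | "2 \<le> d" by linarith
  then show False
  proof cases
    case 3
    then have "card (pverts G) * 2 \<le> card (pverts G) * d" by (rule mult_le_mono2)
    then show False using * by linarith
  qed (use * assms in \<open>auto simp: graph_size_def\<close>)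
qed

text \<open>The sum of squares is an isomorphism invariant of the enlarged tree that reveals the
  fitness of the attachment vertex.\<close>

lemma sum_fitness_power2_add_leaf:
  assumes "w \<notin> pverts G" "u \<in> pverts G"
  shows "(\<Sum>v\<in>pverts (add_leaf u w G). (fitness \<alpha> (add_leaf u w G) v)\<^sup>2)
    = (\<Sum>v\<in>pverts G. (fitness \<alpha> G v)\<^sup>2) + 2 * fitness \<alpha> G u + 1 + \<alpha>\<^sup>2"
proof -
  let ?x = "(fitness \<alpha> G)(u := fitness \<alpha> G u + 1, w := \<alpha>)"
  have "(\<Sum>v\<in>pverts (add_leaf u w G). (fitness \<alpha> (add_leaf u w G) v)\<^sup>2) = (\<Sum>v\<in>insert w (pverts G). (?x v)\<^sup>2)"
    by (rule sum.cong) (use fitness_add_leaf[OF assms] in \<open>auto simp: add_leaf_def\<close>)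
  also have "\<dots> = \<alpha>\<^sup>2 + (\<Sum>v\<in>pverts G. (?x v)\<^sup>2)"
    using assms(1) pair_finite_verts by simp
  also have "(\<Sum>v\<in>pverts G. (?x v)\<^sup>2)
      = (\<Sum>v\<in>pverts G. (fitness \<alpha> G v)\<^sup>2 + (if v = u then 2 * fitness \<alpha> G u + 1 else 0))"
    by (rule sum.cong) (use assms(1) in \<open>auto simp: power2_eq_square algebra_simps\<close>)
  also have "\<dots> = (\<Sum>v\<in>pverts G. (fitness \<alpha> G v)\<^sup>2) + (2 * fitness \<alpha> G u + 1)"
    using assms(2) pair_finite_verts by (simp add: sum.distrib)
  finally show ?thesis by simp
qed

end

text \<open>If the sizes differ, any tree grown from \<open>S\<close> to one vertex less than
  \<open>S'\<close> has two vertices of different degree. Attaching at them gives different sums of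
  squared degrees, so the two results are not both isomorphic to \<open>S'\<close>.\<close>

lemma exists_tree_not_iso:
  assumes \<alpha>: "0 < \<alpha>" and S: "pair_tree S" "3 \<le> graph_size S" and S': "pair_tree S'"
    and le: "graph_size S \<le> graph_size S'" and niso: "\<not> digraph_iso (with_proj S) (with_proj S')"
  shows "\<exists>T\<in>set_pmf (pa_tree \<alpha> S (graph_size S')). \<not> digraph_iso (with_proj T) (with_proj S')"
proof (cases "graph_size S = graph_size S'")
  case True
  interpret pair_tree S by fact
  have "\<not> digraph_iso (with_proj (seed_embed S)) (with_proj S')"
  proof
    assume "digraph_iso (with_proj (seed_embed S)) (with_proj S')"
    with digraph_iso_seed_embed[OF pair_wf_digraph] have "digraph_iso (with_proj S) (with_proj S')"
      by (rule digraph_iso_trans)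
    with niso show False by contradiction
  qed
  then show ?thesis using True by (simp add: pa_tree_def)
next
  case False
  define n where "n = graph_size S' - 1"
  have n: "graph_size S \<le> n" "graph_size S' = Suc n" using False le S by (auto simp: n_def)
  have S2: "2 \<le> graph_size S" using S by simp
  obtain T where T: "T \<in> set_pmf (pa_tree \<alpha> S n)"
    using set_pmf_not_empty[of "pa_tree \<alpha> S n"] by blast
  note sup = pa_tree_support[OF \<alpha> S(1) S2 T n(1)]
  interpret pair_tree T by (rule sup)
  let ?w = "Inr n :: 'a + nat"
  have in_sup: "add_leaf u ?w T \<in> set_pmf (pa_tree \<alpha> S (graph_size S'))" if "u \<in> pverts T" for u
  proof -
    have "u \<in> set_pmf (attach_pmf \<alpha> T)"
      using that sup(2) S2 n(1) by (simp add: set_attach_pmf[OF \<alpha>])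
    then have "add_leaf u ?w T \<in> set_pmf (pa_step \<alpha> T)"
      unfolding pa_step_def sup(2) set_map_pmf by (rule imageI)
    then show ?thesis
      unfolding n(2) pa_tree_Suc[OF \<alpha> S(1) S2 n(1)] set_bind_pmf using T by blast
  qed
  \<comment> \<open>At the parameter \<open>1\<close> the fitness is the degree.\<close>
  obtain u v where uv: "u \<in> pverts T" "v \<in> pverts T" "fitness 1 T u \<noteq> fitness 1 T v"
  proof -
    have "3 \<le> graph_size T" using sup(2) S(2) n(1) by simp
    from exists_fitness_neq[OF this, of 1] show ?thesis using that by blast
  qed
  show ?thesis
  proof (rule ccontr)
    assume "\<not> ?thesis"
    then have iso: "digraph_iso (with_proj (add_leaf x ?w T)) (with_proj S')" if "x \<in> pverts T" for x
      using in_sup that by blast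
    have "(\<Sum>v\<in>pverts S'. (fitness 1 S' v)\<^sup>2)
        = (\<Sum>v\<in>pverts T. (fitness 1 T v)\<^sup>2) + 2 * fitness 1 T x + 1 + 1\<^sup>2" if x: "x \<in> pverts T" for x
    proof -
      interpret X: pair_tree "add_leaf x ?w T" using sup x by (intro pair_tree_add_leaf)
      show ?thesis
        using digraph_iso_sum_fitness[OF X.pair_wf_digraph iso[OF x], of power2 1]
          sum_fitness_power2_add_leaf[OF sup(3) x, of 1] by simp
    qed
    from this[OF uv(1)] this[OF uv(2)] show False using uv(3) by simp
  qed
qed

text \<open>The pattern is a copy of a tree that can grow from \<open>S\<close> and is not
  isomorphic to \<open>S'\<close>. Its observable has positive mean from \<open>S\<close>, whereas
  at this size the other process is still at its seed, into which the pattern does not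
  embed.\<close>

lemma exists_separating_obs:
  assumes \<alpha>: "0 < \<alpha>" and S: "pair_tree S" "3 \<le> graph_size S" and S': "pair_tree S'"
    and le: "graph_size S \<le> graph_size S'" and niso: "\<not> digraph_iso (with_proj S) (with_proj S')"
  shows "\<exists>A E l. finite (A :: nat set) \<and> irrefl E \<and> (\<forall>a\<in>A. 1 + \<alpha> < real (l a)) \<and>
    mean_obs \<alpha> S A E l (graph_size S') \<noteq> mean_obs \<alpha> S' A E l (graph_size S')"
proof -
  let ?k = "graph_size S'"
  have S2: "2 \<le> graph_size S" and S2': "2 \<le> graph_size S'" using S le by auto
  obtain T where T: "T \<in> set_pmf (pa_tree \<alpha> S ?k)" "\<not> digraph_iso (with_proj T) (with_proj S')"
    using exists_tree_not_iso[OF assms] by blast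
  note sup = pa_tree_support[OF \<alpha> S(1) S2 T(1) le]
  interpret T: pair_tree T by (rule sup)
  \<comment> \<open>A copy with vertices in \<open>nat\<close> gives the pattern a type independent
    of the seeds.\<close>
  let ?H = "representative (iso_class T)"
  have iso: "digraph_iso (with_proj T) (with_proj ?H)" using sup(1) by (rule digraph_iso_representative)
  interpret H: pair_tree ?H using iso by (rule T.pair_tree_digraph_iso)
  have size: "graph_size ?H = ?k" using digraph_iso_graph_size[OF T.pair_wf_digraph iso] sup by simp
  interpret S': pair_tree S' by fact
  have isoS': "digraph_iso (with_proj S') (with_proj (seed_embed S'))"
    using S'.pair_wf_digraph by (rule digraph_iso_seed_embed)
  obtain L :: nat where L: "1 + \<alpha> < real L" using reals_Archimedean2 by blast
  let ?o = "obs \<alpha> (pverts ?H) (parcs ?H) (\<lambda>_. L)"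
  have "0 < ?o ?H"
    using size S2' by (intro H.obs_self_pos \<alpha>) simp
  then have "0 < ?o T"
    by (simp only: T.obs_iso[OF iso])
  then have "0 < mean_obs \<alpha> S (pverts ?H) (parcs ?H) (\<lambda>_. L) ?k"
    by (rule mean_obs_pos[OF \<alpha> S(1) S2 le T(1)])
  moreover have "mean_obs \<alpha> S' (pverts ?H) (parcs ?H) (\<lambda>_. L) ?k = 0"
  proof -
    have "\<not> digraph_iso (with_proj ?H) (with_proj S')"
    proof
      assume "digraph_iso (with_proj ?H) (with_proj S')"
      with iso have "digraph_iso (with_proj T) (with_proj S')" by (rule digraph_iso_trans)
      with T(2) show False by contradiction
    qed
    then have "?o S' = 0" using H.obs_eq_0[OF S'] size by simp
    then have "?o (seed_embed S') = 0" by (simp only: S'.obs_iso[OF isoS'])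
    then show ?thesis by (simp add: mean_obs_def pa_tree_def)
  qed
  moreover have "irrefl (parcs ?H)" using H.pair_no_loops by (force simp: irrefl_def)
  ultimately show ?thesis
    by (intro exI[of _ "pverts ?H"] exI[of _ "parcs ?H"] exI[of _ "\<lambda>_. L"])
       (simp add: L H.pair_finite_verts)
qed

section \<open>From a separating observable to a lower bound on the distance\<close>

lemma tv_dist_lower_bound:
  fixes S :: "'a pair_pre_digraph" and S' :: "'b pair_pre_digraph"
  assumes \<alpha>: "0 < \<alpha>"
    and S: "pair_tree S" "2 \<le> graph_size S" "graph_size S \<le> k"
    and S': "pair_tree S'" "2 \<le> graph_size S'" "graph_size S' \<le> k"
    and A: "finite (A :: 'p set)" "\<forall>a\<in>A. 1 + \<alpha> < real (l a)" and E: "irrefl E"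
    and neq: "mean_obs \<alpha> S A E l k \<noteq> mean_obs \<alpha> S' A E l k"
  shows "\<exists>c>0. \<forall>n\<ge>k. c \<le> tv_dist (unlabelled_pa_tree \<alpha> S n) (unlabelled_pa_tree \<alpha> S' n)"
proof -
  let ?Z = "total_fitness \<alpha>"
  \<comment> \<open>This condition survives what the recursion does to a pattern: deleting a vertex
    and raising an exponent.\<close>
  define big where "big A l \<longleftrightarrow> finite A \<and> (\<forall>a\<in>A. 1 + \<alpha> < real (l a))" for A :: "'p set" and l
  define \<delta> where "\<delta> A l n = mean_obs \<alpha> S A E l n - mean_obs \<alpha> S' A E l n" for A :: "'p set" and l n
  have Z: "0 < ?Z n" if "k \<le> n" for n
    using that S \<alpha> by (intro total_fitness_pos) auto
  \<comment> \<open>When the means agree at time \<open>n\<close> for all patterns with fewer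
    vertices, the correction terms of \<open>mean_obs_Suc\<close> cancel in the difference.\<close>
  have \<delta>_Suc: "?Z n * \<delta> B m (Suc n) = (?Z n + real (sum m B)) * \<delta> B m n"
    if B: "big B m" and n: "k \<le> n"
      and IH: "\<And>C m'. card C < card B \<Longrightarrow> big C m' \<Longrightarrow> \<delta> C m' n = 0" for B m n
  proof -
    have fin: "finite B" using B by (simp add: big_def)
    have small: "mean_obs \<alpha> S (B - {a}) E m' n = mean_obs \<alpha> S' (B - {a}) E m' n"
      if "a \<in> B" "big (B - {a}) m'" for a m'
      using IH[of "B - {a}" m'] that fin card_Diff1_less[OF fin] by (simp add: \<delta>_def)
    have big: "big (B - {a}) m" "big (B - {a}) (m(p := Suc (m p)))" for a p
      using B by (auto simp: big_def)
    have n': "graph_size S \<le> n" "graph_size S' \<le> n" using n S S' by auto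
    let ?t = "\<lambda>f a. pochhammer \<alpha> (m a) *
      (if nbrs E B a = {} then (?Z n + real (sum m (B - {a}))) * f (B - {a}) m
       else if is_singleton (nbrs E B a)
       then let p = the_elem (nbrs E B a) in f (B - {a}) (m(p := Suc (m p)))
       else 0)"
    have "(\<Sum>a\<in>B. ?t (\<lambda>C m'. mean_obs \<alpha> S C E m' n) a) = (\<Sum>a\<in>B. ?t (\<lambda>C m'. mean_obs \<alpha> S' C E m' n) a)"
    proof (rule sum.cong[OF refl])
      fix a assume "a \<in> B"
      then show "?t (\<lambda>C m'. mean_obs \<alpha> S C E m' n) a = ?t (\<lambda>C m'. mean_obs \<alpha> S' C E m' n) a"
        by (simp add: small big Let_def)
    qed
    then show ?thesis
      using mean_obs_Suc[OF \<alpha> S(1,2) fin E n'(1), of m] mean_obs_Suc[OF \<alpha> S'(1,2) fin E n'(2), of m]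
      unfolding \<delta>_def right_diff_distrib by linarith
  qed
  define P where "P q \<longleftrightarrow> big (fst q) (snd q) \<and> \<delta> (fst q) (snd q) k \<noteq> 0" for q
  have "P (A, l)" using A neq by (simp add: P_def big_def \<delta>_def)
  \<comment> \<open>The relation \<open>E\<close> stays fixed; the minimum ranges over the point
    sets and exponents.\<close>
  then obtain q where q: "P q" and least: "\<And>r. P r \<Longrightarrow> card (fst q) \<le> card (fst r)"
    using ex_has_least_nat[of P _ "\<lambda>r. card (fst r)"] by blast
  define A0 l0 where "A0 = fst q" and "l0 = snd q"
  have A0: "big A0 l0" "\<delta> A0 l0 k \<noteq> 0" using q by (simp_all add: P_def A0_def l0_def)
  have min: "\<delta> B m k = 0" if "card B < card A0" "big B m" for B m
    using least[of "(B, m)"] that by (auto simp: P_def A0_def)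
  \<comment> \<open>Agreement at time \<open>k\<close> propagates to all later times, for all
    patterns below the minimal size simultaneously.\<close>
  have zero: "\<delta> B m n = 0" if "card B < card A0" "big B m" "k \<le> n" for B m n
    using that(3,1,2)
  proof (induction n arbitrary: B m rule: dec_induct)
    case base
    then show ?case using min by blast
  next
    case (step n)
    have "?Z n * \<delta> B m (Suc n) = 0"
      using \<delta>_Suc[OF step.prems(2), of n] step by simp
    then show ?case using Z[of n] step by simp
  qed
  define s where "s = real (sum l0 A0)"
  define G where "G n = growth ?Z k s n" for n
  have G: "0 < G n" for n unfolding G_def s_def by (intro growth_pos Z of_nat_0_le_iff)
  have \<delta>: "\<delta> A0 l0 n = \<delta> A0 l0 k * G n" if "k \<le> n" for n
    using that
  proof (induction n rule: dec_induct)
    case base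
    then show ?case by (simp add: G_def)
  next
    case (step n)
    have "?Z n * \<delta> A0 l0 (Suc n) = (?Z n + s) * \<delta> A0 l0 n"
      unfolding s_def by (rule \<delta>_Suc) (use A0 zero step in auto)
    then have "\<delta> A0 l0 (Suc n) = (1 + s / ?Z n) * \<delta> A0 l0 n"
      using Z[of n] step by (simp add: field_simps)
    then show ?case using step by (simp add: G_def growth_Suc)
  qed
  have A0': "finite A0" "\<And>a. a \<in> A0 \<Longrightarrow> 1 + \<alpha> < real (l0 a)" using A0(1) by (simp_all add: big_def)
  have "\<exists>C. \<forall>n\<ge>k. measure_pmf.expectation (pa_tree \<alpha> S n) (\<lambda>T. (obs \<alpha> A0 E l0 T)\<^sup>2) \<le> C * (G n)\<^sup>2"
    unfolding G_def s_def by (rule mean_obs_power2_le_growth[OF \<alpha> S(1,2,3)]) (use A0' in auto)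
  then obtain C where C: "measure_pmf.expectation (pa_tree \<alpha> S n) (\<lambda>T. (obs \<alpha> A0 E l0 T)\<^sup>2) \<le> C * (G n)\<^sup>2"
    if "k \<le> n" for n by blast
  have "\<exists>C. \<forall>n\<ge>k. measure_pmf.expectation (pa_tree \<alpha> S' n) (\<lambda>T. (obs \<alpha> A0 E l0 T)\<^sup>2) \<le> C * (G n)\<^sup>2"
    unfolding G_def s_def by (rule mean_obs_power2_le_growth[OF \<alpha> S'(1,2,3)]) (use A0' in auto)
  then obtain C' where C': "measure_pmf.expectation (pa_tree \<alpha> S' n) (\<lambda>T. (obs \<alpha> A0 E l0 T)\<^sup>2) \<le> C' * (G n)\<^sup>2"
    if "k \<le> n" for n by blast
  \<comment> \<open>The added \<open>1\<close> makes \<open>M\<close> positive, and \<open>e\<close>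
    is chosen with \<open>e * M = D / 2\<close>, so that the second moments absorb only half of
    \<open>D\<close>.\<close>
  define M where "M = \<bar>C\<bar> + \<bar>C'\<bar> + 1"
  define D where "D = \<bar>\<delta> A0 l0 k\<bar>"
  define e where "e = D / (2 * M)"
  have pos: "0 < M" "0 < D" "0 < e" using A0(2) by (auto simp: M_def D_def e_def)
  have "D * e / 4 \<le> tv_dist (unlabelled_pa_tree \<alpha> S n) (unlabelled_pa_tree \<alpha> S' n)" if n: "k \<le> n" for n
  proof -
    let ?p = "unlabelled_pa_tree \<alpha> S n" and ?q = "unlabelled_pa_tree \<alpha> S' n"
    \<comment> \<open>After division by \<open>G n\<close> the means differ by the constant
      \<open>\<delta> A0 l0 k\<close>, and the second moments stay bounded in
      \<open>n\<close>.\<close>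
    let ?f = "\<lambda>c. obs \<alpha> A0 E l0 (representative c) / G n"
    have n': "graph_size S \<le> n" "graph_size S' \<le> n" using n S S' by auto
    note exp = expectation_unlabelled_obs[OF \<alpha> S(1,2) n'(1), of _ A0 E l0]
      expectation_unlabelled_obs[OF \<alpha> S'(1,2) n'(2), of _ A0 E l0]
    have "measure_pmf.expectation ?p ?f - measure_pmf.expectation ?q ?f = \<delta> A0 l0 k"
      using \<delta>[OF n] G[of n] exp[of "\<lambda>t. t / G n"]
      by (simp add: \<delta>_def mean_obs_def field_simps)
    then have "D = \<bar>measure_pmf.expectation ?p ?f - measure_pmf.expectation ?q ?f\<bar>"
      by (simp only: D_def)
    also have "\<dots> \<le> e * (measure_pmf.expectation ?p (\<lambda>c. (?f c)\<^sup>2)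
        + measure_pmf.expectation ?q (\<lambda>c. (?f c)\<^sup>2)) + 2 * tv_dist ?p ?q / e"
      by (intro expectation_diff_le_second_moment finite_set_unlabelled \<alpha> S S' pos)
    also have "measure_pmf.expectation ?p (\<lambda>c. (?f c)\<^sup>2) \<le> C"
      using C[OF n] G[of n] exp(1)[of "\<lambda>t. (t / G n)\<^sup>2"] by (simp add: power_divide pos_divide_le_eq)
    also have "measure_pmf.expectation ?q (\<lambda>c. (?f c)\<^sup>2) \<le> C'"
      using C'[OF n] G[of n] exp(2)[of "\<lambda>t. (t / G n)\<^sup>2"] by (simp add: power_divide pos_divide_le_eq)
    also have "C + C' \<le> M" by (simp add: M_def)
    also have "e * M = D / 2" using pos by (simp add: e_def)
    finally have "D / 2 \<le> 2 * tv_dist ?p ?q / e" using pos(3) by simp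
    then show ?thesis using pos(3) by (simp add: pos_le_divide_eq)
  qed
  moreover have "0 < D * e / 4" using pos by simp
  ultimately show ?thesis by blast
qed

lemma tv_dist_lower_bound_not_iso:
  assumes \<alpha>: "0 < \<alpha>" and S: "pair_tree S" "3 \<le> graph_size S" and S': "pair_tree S'"
    and le: "graph_size S \<le> graph_size S'" and niso: "\<not> digraph_iso (with_proj S) (with_proj S')"
  shows "\<exists>c>0. \<forall>n\<ge>graph_size S'.
    c \<le> tv_dist (unlabelled_pa_tree \<alpha> S n) (unlabelled_pa_tree \<alpha> S' n)"
proof -
  obtain A :: "nat set" and E l where "finite A" "irrefl E" "\<forall>a\<in>A. 1 + \<alpha> < real (l a)"
    "mean_obs \<alpha> S A E l (graph_size S') \<noteq> mean_obs \<alpha> S' A E l (graph_size S')"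
    using exists_separating_obs[OF assms] by blast
  then show ?thesis
    using assms by (intro tv_dist_lower_bound[of \<alpha> S "graph_size S'" S' A l E]) auto
qed

theorem theorem1p1:
  fixes \<alpha> :: real
    and S :: "'a pair_pre_digraph" and S' :: "'b pair_pre_digraph"
  assumes "\<alpha> > 0"
    and "pair_tree S" and "3 \<le> graph_size S"
    and "pair_tree S'" and "3 \<le> graph_size S'"
  shows "\<exists>d. (\<lambda>n. tv_dist (unlabelled_pa_tree \<alpha> S n) (unlabelled_pa_tree \<alpha> S' n)) \<longlonglongrightarrow> d \<and>
             (\<not> digraph_iso (with_proj S) (with_proj S') \<longrightarrow> d \<noteq> 0)"
proof -
  define k where "k = max (graph_size S) (graph_size S')"
  define X where "X n = tv_dist (unlabelled_pa_tree \<alpha> S n) (unlabelled_pa_tree \<alpha> S' n)" for n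
  \<comment> \<open>Monotonicity starts at \<open>k\<close>, from where both processes are
    defined.\<close>
  have "decseq (\<lambda>n. X (n + k))"
    unfolding decseq_Suc_iff X_def add_Suc
    using assms by (intro allI tv_dist_Suc_le) (auto simp: k_def)
  then obtain d where "(\<lambda>n. X (n + k)) \<longlonglongrightarrow> d"
    using decseq_convergent[of "\<lambda>n. X (n + k)" 0] by (auto simp: X_def tv_dist_nonneg)
  then have lim: "X \<longlonglongrightarrow> d" by (rule LIMSEQ_offset)
  have "d \<noteq> 0" if niso: "\<not> digraph_iso (with_proj S) (with_proj S')"
  proof -
    interpret S: pair_tree S by fact
    interpret S': pair_tree S' by fact
    have niso': "\<not> digraph_iso (with_proj S') (with_proj S)"
      using niso digraph_iso_swap[OF S'.wf_digraph] by blast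
    \<comment> \<open>Either seed may be the smaller one; the distance and the isomorphism relation
      are symmetric.\<close>
    have "\<exists>c>0. \<forall>n\<ge>k. c \<le> X n"
    proof (cases "graph_size S \<le> graph_size S'")
      case True
      then show ?thesis
        using tv_dist_lower_bound_not_iso[OF assms(1-4) True niso] by (simp add: X_def k_def max_absorb2)
    next
      case False
      then show ?thesis
        using tv_dist_lower_bound_not_iso[OF assms(1,4,5,2) _ niso']
        by (simp add: X_def k_def max_absorb1 tv_dist_commute)
    qed
    then obtain c where "c > 0" "\<And>n. k \<le> n \<Longrightarrow> c \<le> X n" by blast
    moreover from this have "c \<le> d" by (intro LIMSEQ_le_const[OF lim]) blast
    ultimately show ?thesis by simp
  qed
  then show ?thesis using lim unfolding X_def by blast
qed

end
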